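(* Let $\alpha\in\mathbb{N}$. Suppose $g:\mathbb{R}\to\mathbb{R}$ is such that $g^{(\tau)}$ is absolutely continuous on every compact interval for $\tau=0,\dots,\alpha-1$, $g^{(\alpha)}\in L^2(\mathbb{R})$, \[ \|g\|_\alpha^*:=\sup_{I\subset\mathbb{R},\ |I|<\infty}\left(\sum_{\tau=0}^{\alpha-1}\left(\int_I g^{(\tau)}(x)\,\mathrm{d}x\right)^2+\int_I|g^{(\alpha)}(x)|^2\,\mathrm{d}x\right)^{1/2}<\infty, \] (supremum over intervals $I$ of finite length) and, for some $\varepsilon\in(0,1)$, \[ \|g\|_{\alpha,\mathrm{decay}}:=\sup_{x\in\mathbb{R},\ \tau\in\{0,\dots,\alpha-1\}}\left|\mathrm{e}^{(1-\varepsilon)x^2/2}g^{(\tau)}(x)\right|<\infty. \] Let $\gamma:\mathbb{N}\to[0,\infty)$ be non-decreasing with $\lim_{n\to\infty}\gamma(n)=\infty$, and let $\gamma^{-1}(\alpha):=\min\{m\in\mathbb{N}: \gamma(m)\geq\alpha\}$. Then for every integer $n\geq\gamma^{-1}(\alpha)$, with $\tilde T=\sqrt{\frac{2}{1-\varepsilon}\gamma(n)\ln(n)}$, \[ \left|\int_\mathbb{R}g(x)\,\mathrm{d}x-Q_{n,\tilde T}^*(g)\right|\leq C\left(\|g\|_\alpha^*+\|g\|_{\alpha,\mathrm{decay}}\right)\frac{(\gamma(n)\ln n)^{\alpha/2+1/4}}{n^\alpha}, \] where the constant $C$ is independent of $n$ and $g$ but depends on $\alpha$ and $\varepsilon$.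
   Context: For $T>0$ and $n\in\mathbb{N}$, the trapezoidal rule is $Q_{n,T}^*(g)=\frac{2T}{n}\sum_{j=0}^{n-1}g(\xi_j^* )$ with $\xi_j^*=\frac{2T}{n}j-T$, $j=0,\dots,n-1$. *)

theory Defs
  imports "HOL-Analysis.Analysis"
begin

text \<open>Absolute continuity of a real function on a compact interval [a,b]
  (classical epsilon-delta definition via finite families of pairwise
  non-overlapping subintervals).\<close>
definition abs_cont_on_interval :: "(real \<Rightarrow> real) \<Rightarrow> real \<Rightarrow> real \<Rightarrow> bool" where
  "abs_cont_on_interval f a b \<longleftrightarrow>
     (\<forall>e>0. \<exists>d>0. \<forall>(n::nat) (l::nat \<Rightarrow> real) (r::nat \<Rightarrow> real).
        (\<forall>i<n. a \<le> l i \<and> l i < r i \<and> r i \<le> b) \<and>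
        (\<forall>i<n. \<forall>j<n. i \<noteq> j \<longrightarrow> {l i<..<r i} \<inter> {l j<..<r j} = {}) \<and>
        (\<Sum>i<n. r i - l i) < d
        \<longrightarrow> (\<Sum>i<n. \<bar>f (r i) - f (l i)\<bar>) < e)"

text \<open>Trapezoidal rule Q*_{n,T}(g) = (2T/n) sum_{j=0}^{n-1} g(2T j/n - T).\<close>
definition trap_rule :: "nat \<Rightarrow> real \<Rightarrow> (real \<Rightarrow> real) \<Rightarrow> real" where
  "trap_rule n T g = (2 * T / real n) * (\<Sum>j<n. g (2 * T / real n * real j - T))"

text \<open>The quantity inside the supremum defining the norm ||g||*_alpha,
  for the interval [a,b]; G tau plays the role of g^(tau).\<close>
definition star_norm_term :: "nat \<Rightarrow> (nat \<Rightarrow> real \<Rightarrow> real) \<Rightarrow> real \<Rightarrow> real \<Rightarrow> real" where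
  "star_norm_term \<alpha> G a b =
     sqrt ((\<Sum>\<tau><\<alpha>. (LINT x:{a..b}|lborel. G \<tau> x)\<^sup>2) + (LINT x:{a..b}|lborel. (G \<alpha> x)\<^sup>2))"

definition star_norm :: "nat \<Rightarrow> (nat \<Rightarrow> real \<Rightarrow> real) \<Rightarrow> real" where
  "star_norm \<alpha> G = (SUP ab\<in>{(a, b). a \<le> b}. star_norm_term \<alpha> G (fst ab) (snd ab))"

definition decay_norm_term :: "real \<Rightarrow> (nat \<Rightarrow> real \<Rightarrow> real) \<Rightarrow> real \<Rightarrow> nat \<Rightarrow> real" where
  "decay_norm_term \<epsilon> G x \<tau> = \<bar>exp ((1 - \<epsilon>) * x\<^sup>2 / 2) * G \<tau> x\<bar>"

definition decay_norm :: "nat \<Rightarrow> real \<Rightarrow> (nat \<Rightarrow> real \<Rightarrow> real) \<Rightarrow> real" where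
  "decay_norm \<alpha> \<epsilon> G = (SUP p\<in>UNIV \<times> {..<\<alpha>}. decay_norm_term \<epsilon> G (fst p) (snd p))"

text \<open>gamma^{-1}(alpha) = min { m. gamma m \<ge> alpha }.\<close>
definition gamma_inv :: "(nat \<Rightarrow> real) \<Rightarrow> nat \<Rightarrow> nat" where
  "gamma_inv \<gamma> \<alpha> = (LEAST m. \<gamma> m \<ge> real \<alpha>)"

end

(* On [-T, T] the nodes of Q*_{n,T} are the left endpoints of n cells of width h = 2T/n, so there
   Q*_{n,T} is the left endpoint rule. Taylor expansion of g on each cell to order alpha - 1
   expresses its error E(g) through h^alpha * integral |g^(alpha)| and the Riemann sums of
   g', ..., g^(alpha-1); the Riemann sum of g^(l) is the integral of g^(l), i.e. the boundary
   difference g^(l-1)(T) - g^(l-1)(-T), minus the error E(g^(l)). Solving this recursion bounds E(g)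
   by h^alpha * integral_{-T..T} |g^(alpha)| plus the boundary differences weighted by powers of h.
   Cauchy-Schwarz bounds the integral by sqrt(2T) ||g||*_alpha. The Gaussian decay bounds the
   boundary differences and the two tails outside [-T, T] by multiples of
   ||g||_decay exp(-(1-eps) T^2/2) = ||g||_decay n^(-gamma(n)) <= ||g||_decay n^(-alpha), and the
   remaining factor (2T)^(alpha+1/2) is a multiple of (gamma(n) ln n)^(alpha/2+1/4).
   Absolute continuity enters through Lusin's property (N): it turns the almost-everywhere
   derivatives into genuine ones and gives |g^(alpha-1)(v) - g^(alpha-1)(u)| <= integral_u^v |g^(alpha)|. *)

theory Submission
  imports Defs
begin

section \<open>Absolutely continuous functions\<close>

lemma abs_cont_on_intervalE:
  assumes "abs_cont_on_interval F a b" "e > 0"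
  obtains d where "d > 0"
    "\<And>(n::nat) l r. \<forall>i<n. a \<le> l i \<and> l i < r i \<and> r i \<le> b \<Longrightarrow>
        \<forall>i<n. \<forall>j<n. i \<noteq> j \<longrightarrow> {l i<..<r i} \<inter> {l j<..<r j} = {} \<Longrightarrow>
        (\<Sum>i<n. r i - l i) < d \<Longrightarrow> (\<Sum>i<n. \<bar>F (r i) - F (l i)\<bar>) < e"
proof -
  obtain d where "d > 0" and small: "\<forall>(n::nat) l r. (\<forall>i<n. a \<le> l i \<and> l i < r i \<and> r i \<le> b) \<and>
        (\<forall>i<n. \<forall>j<n. i \<noteq> j \<longrightarrow> {l i<..<r i} \<inter> {l j<..<r j} = {}) \<and>
        (\<Sum>i<n. r i - l i) < d \<longrightarrow> (\<Sum>i<n. \<bar>F (r i) - F (l i)\<bar>) < e"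
    using assms unfolding abs_cont_on_interval_def by blast
  show ?thesis
    by (rule that[OF \<open>d > 0\<close>], rule small[rule_format]) blast
qed

lemma abs_cont_on_interval_finite_family:
  assumes "abs_cont_on_interval F a b" "e > 0"
  obtains d where "d > 0"
    "\<And>D l r. finite D \<Longrightarrow> (\<And>K. K \<in> D \<Longrightarrow> a \<le> l K \<and> l K \<le> r K \<and> r K \<le> b) \<Longrightarrow>
        disjoint_family_on (\<lambda>K. {l K<..<r K}) D \<Longrightarrow>
        (\<Sum>K\<in>D. r K - l K) < d \<Longrightarrow> (\<Sum>K\<in>D. \<bar>F (r K) - F (l K)\<bar>) < e"
proof -
  obtain d where d: "d > 0" and small: "\<And>(n::nat) l r. \<forall>i<n. a \<le> l i \<and> l i < r i \<and> r i \<le> b \<Longrightarrow>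
        \<forall>i<n. \<forall>j<n. i \<noteq> j \<longrightarrow> {l i<..<r i} \<inter> {l j<..<r j} = {} \<Longrightarrow>
        (\<Sum>i<n. r i - l i) < d \<Longrightarrow> (\<Sum>i<n. \<bar>F (r i) - F (l i)\<bar>) < e"
    using abs_cont_on_intervalE[OF assms] by blast
  have "(\<Sum>K\<in>D. \<bar>F (r K) - F (l K)\<bar>) < e"
    if D: "finite D" and lr: "\<And>K. K \<in> D \<Longrightarrow> a \<le> l K \<and> l K \<le> r K \<and> r K \<le> b"
      and disj: "disjoint_family_on (\<lambda>K. {l K<..<r K}) D" and len: "(\<Sum>K\<in>D. r K - l K) < d"
    for D l r
  proof -
    \<comment> \<open>Degenerate intervals contribute to neither sum, and the rest can be enumerated.\<close>
    define D' where "D' = {K \<in> D. l K < r K}"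
    have D': "finite D'" "D' \<subseteq> D" using D by (auto simp: D'_def)
    have sum_D': "(\<Sum>K\<in>D'. f K) = (\<Sum>K\<in>D. f K)" if "\<And>K. l K = r K \<Longrightarrow> f K = 0" for f
    proof (rule sum.mono_neutral_left[OF D D'(2)], intro ballI)
      fix K assume "K \<in> D - D'"
      then have "l K = r K" using lr[of K] unfolding D'_def by auto
      then show "f K = 0" by (rule that)
    qed
    have len': "(\<Sum>K\<in>D'. r K - l K) < d"
      using len sum_D'[of "\<lambda>K. r K - l K"] by simp
    have sum_eq: "(\<Sum>K\<in>D'. \<bar>F (r K) - F (l K)\<bar>) = (\<Sum>K\<in>D. \<bar>F (r K) - F (l K)\<bar>)"
      by (rule sum_D') simp
    obtain k where k: "bij_betw k {..<card D'} D'"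
      using ex_bij_betw_nat_finite[OF D'(1)] by (auto simp: atLeast0LessThan)
    have k_in: "k i \<in> D'" if "i < card D'" for i
      using k that by (auto simp: bij_betw_def)
    have k_inj: "k i \<noteq> k j" if "i < card D'" "j < card D'" "i \<noteq> j" for i j
      using k that by (auto simp: bij_betw_def inj_on_def)
    have "(\<Sum>i<card D'. \<bar>F (r (k i)) - F (l (k i))\<bar>) < e"
    proof (rule small)
      show "\<forall>i<card D'. a \<le> l (k i) \<and> l (k i) < r (k i) \<and> r (k i) \<le> b"
      proof (intro allI impI)
        fix i assume "i < card D'"
        then have "k i \<in> D" "l (k i) < r (k i)" using k_in[of i] unfolding D'_def by auto
        then show "a \<le> l (k i) \<and> l (k i) < r (k i) \<and> r (k i) \<le> b" using lr[of "k i"] by auto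
      qed
      show "\<forall>i<card D'. \<forall>j<card D'. i \<noteq> j \<longrightarrow> {l (k i)<..<r (k i)} \<inter> {l (k j)<..<r (k j)} = {}"
      proof (intro allI impI)
        fix i j assume "i < card D'" "j < card D'" "i \<noteq> j"
        then show "{l (k i)<..<r (k i)} \<inter> {l (k j)<..<r (k j)} = {}"
          using disj k_in[of i] k_in[of j] k_inj[of i j] D'(2) unfolding disjoint_family_on_def by blast
      qed
      show "(\<Sum>i<card D'. r (k i) - l (k i)) < d"
        using len' sum.reindex_bij_betw[OF k, of "\<lambda>K. r K - l K"] by simp
    qed
    then show ?thesis
      using sum_eq sum.reindex_bij_betw[OF k, of "\<lambda>K. \<bar>F (r K) - F (l K)\<bar>"] by simp
  qed
  from d this show ?thesis by (rule that)
qed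

lemma abs_cont_on_interval_continuous_on:
  assumes "abs_cont_on_interval F a b"
  shows "continuous_on {a..b} F"
  unfolding continuous_on_iff
proof (intro ballI allI impI)
  fix x e :: real assume x: "x \<in> {a..b}" and e: "0 < e"
  obtain d where d: "d > 0" and small: "\<And>(n::nat) l r. \<forall>i<n. a \<le> l i \<and> l i < r i \<and> r i \<le> b \<Longrightarrow>
        \<forall>i<n. \<forall>j<n. i \<noteq> j \<longrightarrow> {l i<..<r i} \<inter> {l j<..<r j} = {} \<Longrightarrow>
        (\<Sum>i<n. r i - l i) < d \<Longrightarrow> (\<Sum>i<n. \<bar>F (r i) - F (l i)\<bar>) < e"
    using abs_cont_on_intervalE[OF assms e] by blast
  have "dist (F y) (F x) < e" if y: "y \<in> {a..b}" "dist y x < d" for y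
  proof (cases "y = x")
    case False
    have "(\<Sum>i<Suc 0. \<bar>F (max x y) - F (min x y)\<bar>) < e"
      using small[of 1 "\<lambda>_. min x y" "\<lambda>_. max x y"] x y False
      by (auto simp: dist_real_def min_def max_def)
    then show ?thesis by (auto simp: dist_real_def min_def max_def abs_minus_commute split: if_splits)
  qed (use e in simp)
  with d show "\<exists>d>0. \<forall>y\<in>{a..b}. dist y x < d \<longrightarrow> dist (F y) (F x) < e" by blast
qed

lemma abs_cont_on_interval_subinterval:
  assumes "abs_cont_on_interval F a b" "a \<le> c" "d \<le> b"
  shows "abs_cont_on_interval F c d"
  unfolding abs_cont_on_interval_def
proof (intro allI impI)
  fix e :: real assume "e > 0"
  then obtain \<delta> where "\<delta> > 0" and small: "\<And>(n::nat) l r. \<forall>i<n. a \<le> l i \<and> l i < r i \<and> r i \<le> b \<Longrightarrow>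
        \<forall>i<n. \<forall>j<n. i \<noteq> j \<longrightarrow> {l i<..<r i} \<inter> {l j<..<r j} = {} \<Longrightarrow>
        (\<Sum>i<n. r i - l i) < \<delta> \<Longrightarrow> (\<Sum>i<n. \<bar>F (r i) - F (l i)\<bar>) < e"
    using abs_cont_on_intervalE[OF assms(1)] by blast
  moreover have "\<forall>i<n. a \<le> l i \<and> l i < r i \<and> r i \<le> b" if "\<forall>i<n. c \<le> l i \<and> l i < r i \<and> r i \<le> d" for n :: nat and l r
    using that assms(2,3) by force
  ultimately show "\<exists>\<delta>>0. \<forall>(n::nat) l r. (\<forall>i<n. c \<le> l i \<and> l i < r i \<and> r i \<le> d) \<and>
        (\<forall>i<n. \<forall>j<n. i \<noteq> j \<longrightarrow> {l i<..<r i} \<inter> {l j<..<r j} = {}) \<and>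
        (\<Sum>i<n. r i - l i) < \<delta> \<longrightarrow> (\<Sum>i<n. \<bar>F (r i) - F (l i)\<bar>) < e"
    by blast
qed

lemma abs_cont_on_interval_diff:
  assumes F: "abs_cont_on_interval F a b" and P: "abs_cont_on_interval P a b"
  shows "abs_cont_on_interval (\<lambda>x. F x - P x) a b"
  unfolding abs_cont_on_interval_def
proof (intro allI impI)
  fix e :: real assume e: "e > 0"
  obtain d1 where d1: "d1 > 0" and F_small: "\<And>(n::nat) l r. \<forall>i<n. a \<le> l i \<and> l i < r i \<and> r i \<le> b \<Longrightarrow>
        \<forall>i<n. \<forall>j<n. i \<noteq> j \<longrightarrow> {l i<..<r i} \<inter> {l j<..<r j} = {} \<Longrightarrow>
        (\<Sum>i<n. r i - l i) < d1 \<Longrightarrow> (\<Sum>i<n. \<bar>F (r i) - F (l i)\<bar>) < e/2"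
    using abs_cont_on_intervalE[OF F half_gt_zero[OF e]] by blast
  obtain d2 where d2: "d2 > 0" and P_small: "\<And>(n::nat) l r. \<forall>i<n. a \<le> l i \<and> l i < r i \<and> r i \<le> b \<Longrightarrow>
        \<forall>i<n. \<forall>j<n. i \<noteq> j \<longrightarrow> {l i<..<r i} \<inter> {l j<..<r j} = {} \<Longrightarrow>
        (\<Sum>i<n. r i - l i) < d2 \<Longrightarrow> (\<Sum>i<n. \<bar>P (r i) - P (l i)\<bar>) < e/2"
    using abs_cont_on_intervalE[OF P half_gt_zero[OF e]] by blast
  have "(\<Sum>i<n. \<bar>(F (r i) - P (r i)) - (F (l i) - P (l i))\<bar>) < e"
    if "\<forall>i<n. a \<le> l i \<and> l i < r i \<and> r i \<le> b"
      "\<forall>i<n. \<forall>j<n. i \<noteq> j \<longrightarrow> {l i<..<r i} \<inter> {l j<..<r j} = {}"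
      "(\<Sum>i<n. r i - l i) < min d1 d2" for n :: nat and l r
  proof -
    have "(\<Sum>i<n. \<bar>(F (r i) - P (r i)) - (F (l i) - P (l i))\<bar>)
          \<le> (\<Sum>i<n. \<bar>F (r i) - F (l i)\<bar>) + (\<Sum>i<n. \<bar>P (r i) - P (l i)\<bar>)"
      unfolding sum.distrib[symmetric] by (intro sum_mono) linarith
    also have "\<dots> < e/2 + e/2"
      using F_small[OF that(1,2)] P_small[OF that(1,2)] that(3) by (intro add_strict_mono) auto
    finally show ?thesis by simp
  qed
  then show "\<exists>d>0. \<forall>(n::nat) l r. (\<forall>i<n. a \<le> l i \<and> l i < r i \<and> r i \<le> b) \<and>
        (\<forall>i<n. \<forall>j<n. i \<noteq> j \<longrightarrow> {l i<..<r i} \<inter> {l j<..<r j} = {}) \<and>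
        (\<Sum>i<n. r i - l i) < d \<longrightarrow> (\<Sum>i<n. \<bar>(F (r i) - P (r i)) - (F (l i) - P (l i))\<bar>) < e"
    using d1 d2 by (intro exI[of _ "min d1 d2"]) auto
qed

lemma lipschitz_on_imp_abs_cont_on_interval:
  assumes "M-lipschitz_on {a..b} P"
  shows "abs_cont_on_interval P a b"
  unfolding abs_cont_on_interval_def
proof (intro allI impI)
  fix e :: real assume e: "e > 0"
  define M' where "M' = max M 1"
  have M': "M' > 0" "M \<le> M'" by (auto simp: M'_def)
  have "(\<Sum>i<n. \<bar>P (r i) - P (l i)\<bar>) < e"
    if lr: "\<forall>i<n. a \<le> l i \<and> l i < r i \<and> r i \<le> b" and len: "(\<Sum>i<n. r i - l i) < e / M'" for n :: nat and l r
  proof -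
    have "(\<Sum>i<n. \<bar>P (r i) - P (l i)\<bar>) \<le> (\<Sum>i<n. M' * (r i - l i))"
    proof (intro sum_mono)
      fix i assume "i \<in> {..<n}"
      then have i: "a \<le> l i" "l i < r i" "r i \<le> b" using lr by auto
      have "\<bar>P (r i) - P (l i)\<bar> \<le> M * (r i - l i)"
        using lipschitz_onD[OF assms, of "r i" "l i"] i by (simp add: dist_real_def)
      also have "\<dots> \<le> M' * (r i - l i)" using i M' by (intro mult_right_mono) auto
      finally show "\<bar>P (r i) - P (l i)\<bar> \<le> M' * (r i - l i)" .
    qed
    also have "\<dots> = M' * (\<Sum>i<n. r i - l i)" by (simp add: sum_distrib_left)
    also have "\<dots> < M' * (e / M')" using len M' by (intro mult_strict_left_mono) auto
    finally show ?thesis using M' by simp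
  qed
  then show "\<exists>d>0. \<forall>(n::nat) l r. (\<forall>i<n. a \<le> l i \<and> l i < r i \<and> r i \<le> b) \<and>
        (\<forall>i<n. \<forall>j<n. i \<noteq> j \<longrightarrow> {l i<..<r i} \<inter> {l j<..<r j} = {}) \<and>
        (\<Sum>i<n. r i - l i) < d \<longrightarrow> (\<Sum>i<n. \<bar>P (r i) - P (l i)\<bar>) < e"
    using e M' by (intro exI[of _ "e / M'"]) auto
qed

lemma measure_vec_image_real:
  fixes A :: "real set"
  assumes "(vec ` A :: (real^1) set) \<in> lmeasurable"
  shows "A \<in> lmeasurable" "measure lebesgue A = measure lebesgue (vec ` A :: (real^1) set)"
proof -
  have "((\<lambda>x::real^1. 1::real) has_integral measure lebesgue (vec ` A :: (real^1) set)) (vec ` A)"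
    using assms by (simp add: has_integral_iff lmeasurable_iff_integrable_on lmeasure_integral)
  then have "(((\<lambda>x::real^1. 1::real) \<circ> vec) has_integral measure lebesgue (vec ` A :: (real^1) set))
      ((\<lambda>x. x $ 1) ` (vec ` A :: (real^1) set))"
    by (rule has_integral_vec1_I)
  moreover have "(\<lambda>x. x $ 1) ` (vec ` A :: (real^1) set) = A"
    by (force simp: image_comp o_def)
  ultimately have "((\<lambda>x::real. 1::real) has_integral measure lebesgue (vec ` A :: (real^1) set)) A"
    by (simp add: o_def)
  then show "A \<in> lmeasurable" "measure lebesgue A = measure lebesgue (vec ` A :: (real^1) set)"
    by (metis has_integral_iff lmeasurable_iff_integrable_on lmeasure_integral)+
qed

text \<open>The one-dimensional case of \<open>measure_differentiable_image\<close>, which is stated for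
  \<open>real^'n\<close> and is transported along \<open>vec :: real \<Rightarrow> real^1\<close>.\<close>

lemma measure_differentiable_image_real:
  fixes F g :: "real \<Rightarrow> real"
  assumes S: "S \<in> sets lebesgue"
    and der: "\<And>x. x \<in> S \<Longrightarrow> (F has_real_derivative g x) (at x within S)"
    and int: "(\<lambda>x. \<bar>g x\<bar>) integrable_on S"
  shows "F ` S \<in> lmeasurable" "measure lebesgue (F ` S) \<le> integral S (\<lambda>x. \<bar>g x\<bar>)"
proof -
  let ?lift = "vec :: real \<Rightarrow> real^1"
  let ?drop = "\<lambda>x::real^1. x $ 1"
  have S': "?lift ` S \<in> sets lebesgue"
    by (auto intro: differentiable_image_in_sets_lebesgue [OF S] differentiable_vec)
  have "((\<lambda>x. vec (F (x $ 1))) has_derivative (*\<^sub>R) (g z)) (at (vec z) within ?lift ` S)"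
    if "z \<in> S" for z
    using der [OF that]
    by (simp add: has_real_derivative_iff_has_vector_derivative has_vector_derivative_def
        has_derivative_vector_1)
  then have der': "\<And>x. x \<in> ?lift ` S \<Longrightarrow>
        (?lift \<circ> F \<circ> ?drop has_derivative (*\<^sub>R) (g (?drop x))) (at x within ?lift ` S)"
    by (auto simp: o_def)
  have "((\<lambda>x. \<bar>g x\<bar>) has_integral integral S (\<lambda>x. \<bar>g x\<bar>)) (?drop ` ?lift ` S)"
    using int by (simp add: has_integral_iff image_comp o_def)
  then have "((\<lambda>x::real^1. \<bar>g (x$1)\<bar>) has_integral integral S (\<lambda>x. \<bar>g x\<bar>)) (?lift ` S)"
    by (intro has_integral_vec1_D) (simp add: o_def)
  then have int': "(\<lambda>x::real^1. \<bar>det (matrix ((*\<^sub>R) (g (?drop x))) :: real^1^1)\<bar>) integrable_on ?lift ` S"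
    and int_eq: "integral (?lift ` S) (\<lambda>x::real^1. \<bar>det (matrix ((*\<^sub>R) (g (?drop x))) :: real^1^1)\<bar>)
                 = integral S (\<lambda>x. \<bar>g x\<bar>)"
    by (auto simp: has_integral_iff)
  have image_eq: "(?lift \<circ> F \<circ> ?drop) ` ?lift ` S = ?lift ` (F ` S)"
    by (force simp: image_comp o_def)
  show "F ` S \<in> lmeasurable" "measure lebesgue (F ` S) \<le> integral S (\<lambda>x. \<bar>g x\<bar>)"
    using measurable_differentiable_image[OF S' der' int'] measure_differentiable_image[OF S' der' int']
      measure_vec_image_real[of "F ` S"] int_eq
    unfolding image_eq by auto
qed

lemma sum_interval_lengths_le_measure:
  assumes "finite D" "U \<in> lmeasurable"
    and "\<And>K. K \<in> D \<Longrightarrow> l K \<le> r K \<and> {l K<..<r K} \<subseteq> U"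
    and "disjoint_family_on (\<lambda>K. {l K<..<r K}) D"
  shows "(\<Sum>K\<in>D. r K - l K) \<le> measure lebesgue U"
proof -
  have "(\<Sum>K\<in>D. r K - l K) = (\<Sum>K\<in>D. measure lebesgue {l K<..<r K})"
    using assms(3) by (intro sum.cong) auto
  also have "\<dots> = measure lebesgue (\<Union>K\<in>D. {l K<..<r K})"
    by (rule measure_finite_Union[symmetric]) (use assms in auto)
  also have "\<dots> \<le> measure lebesgue U"
    by (rule measure_mono_fmeasurable) (use assms in auto)
  finally show ?thesis .
qed

lemma continuous_image_interval_measure_le:
  fixes F :: "real \<Rightarrow> real"
  assumes cont: "continuous_on {c..d} F" and cd: "c \<le> d"
  obtains l r where "c \<le> l" "l \<le> r" "r \<le> d"
    "measure lebesgue (F ` {c..d}) \<le> \<bar>F r - F l\<bar>"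
proof -
  obtain p where p: "p \<in> {c..d}" "\<forall>y\<in>{c..d}. F p \<le> F y"
    using continuous_attains_inf[OF compact_Icc _ cont] cd by auto
  obtain q where q: "q \<in> {c..d}" "\<forall>y\<in>{c..d}. F y \<le> F q"
    using continuous_attains_sup[OF compact_Icc _ cont] cd by auto
  have "F ` {c..d} \<in> lmeasurable"
    by (intro lmeasurable_compact compact_continuous_image cont compact_Icc)
  then have "measure lebesgue (F ` {c..d}) \<le> measure lebesgue {F p..F q}"
    using p q by (intro measure_mono_fmeasurable) auto
  also have "F p \<le> F q" using p(2) q(1) by blast
  then have "measure lebesgue {F p..F q} = \<bar>F (max p q) - F (min p q)\<bar>"
    by (auto simp: min_def max_def)
  finally show ?thesis
    using p(1) q(1) by (intro that[of "min p q" "max p q"]) auto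
qed

lemma abs_cont_on_interval_sum_image_measure:
  assumes F: "abs_cont_on_interval F a b" and e: "e > 0"
  obtains \<delta> where "\<delta> > 0"
    "\<And>(D :: 'a set) c d. finite D \<Longrightarrow> (\<And>K. K \<in> D \<Longrightarrow> a \<le> c K \<and> c K \<le> d K \<and> d K \<le> b) \<Longrightarrow>
        disjoint_family_on (\<lambda>K. {c K<..<d K}) D \<Longrightarrow> (\<Sum>K\<in>D. d K - c K) < \<delta> \<Longrightarrow>
        (\<Sum>K\<in>D. measure lebesgue (F ` {c K..d K})) < e"
proof -
  obtain \<delta> where \<delta>: "\<delta> > 0" and small: "\<And>(D :: 'a set) l r. finite D \<Longrightarrow>
        (\<And>K. K \<in> D \<Longrightarrow> a \<le> l K \<and> l K \<le> r K \<and> r K \<le> b) \<Longrightarrow>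
        disjoint_family_on (\<lambda>K. {l K<..<r K}) D \<Longrightarrow>
        (\<Sum>K\<in>D. r K - l K) < \<delta> \<Longrightarrow> (\<Sum>K\<in>D. \<bar>F (r K) - F (l K)\<bar>) < e"
    using abs_cont_on_interval_finite_family[OF F e] by blast
  have "(\<Sum>K\<in>D. measure lebesgue (F ` {c K..d K})) < e"
    if D: "finite D" and cd: "\<And>K. K \<in> D \<Longrightarrow> a \<le> c K \<and> c K \<le> d K \<and> d K \<le> b"
      and disj: "disjoint_family_on (\<lambda>K. {c K<..<d K}) D" and len: "(\<Sum>K\<in>D. d K - c K) < \<delta>"
    for D :: "'a set" and c d
  proof -
    \<comment> \<open>Absolute continuity is applied to the points where \<open>F\<close> attains its extrema on each interval.\<close>
    have "\<exists>l r. c K \<le> l \<and> l \<le> r \<and> r \<le> d K \<and> measure lebesgue (F ` {c K..d K}) \<le> \<bar>F r - F l\<bar>"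
      if K: "K \<in> D" for K
    proof -
      have cont_K: "continuous_on {c K..d K} F"
        using cd[OF K] by (intro continuous_on_subset[OF abs_cont_on_interval_continuous_on[OF F]]) auto
      obtain l r where "c K \<le> l" "l \<le> r" "r \<le> d K" "measure lebesgue (F ` {c K..d K}) \<le> \<bar>F r - F l\<bar>"
        by (rule continuous_image_interval_measure_le[OF cont_K]) (use cd[OF K] in auto)
      then show ?thesis by blast
    qed
    then obtain l r where lr: "\<And>K. K \<in> D \<Longrightarrow> c K \<le> l K \<and> l K \<le> r K \<and> r K \<le> d K \<and>
        measure lebesgue (F ` {c K..d K}) \<le> \<bar>F (r K) - F (l K)\<bar>"
      by metis
    have "(\<Sum>K\<in>D. measure lebesgue (F ` {c K..d K})) \<le> (\<Sum>K\<in>D. \<bar>F (r K) - F (l K)\<bar>)"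
      using lr by (intro sum_mono) blast
    also have "\<dots> < e"
    proof (rule small[OF D])
      fix K assume "K \<in> D"
      then show "a \<le> l K \<and> l K \<le> r K \<and> r K \<le> b" using lr[of K] cd[of K] by auto
    next
      show "disjoint_family_on (\<lambda>K. {l K<..<r K}) D"
        unfolding disjoint_family_on_def
      proof (intro ballI impI)
        fix K K' assume K: "K \<in> D" "K' \<in> D" "K \<noteq> K'"
        then have "{c K<..<d K} \<inter> {c K'<..<d K'} = {}" using disj by (auto simp: disjoint_family_on_def)
        moreover have "{l K<..<r K} \<subseteq> {c K<..<d K}" "{l K'<..<r K'} \<subseteq> {c K'<..<d K'}"
          using lr[OF K(1)] lr[OF K(2)] by auto
        ultimately show "{l K<..<r K} \<inter> {l K'<..<r K'} = {}" by blast
      qed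
    next
      have "(\<Sum>K\<in>D. r K - l K) \<le> (\<Sum>K\<in>D. d K - c K)"
      proof (rule sum_mono)
        fix K assume "K \<in> D"
        then show "r K - l K \<le> d K - c K" using lr[of K] by linarith
      qed
      then show "(\<Sum>K\<in>D. r K - l K) < \<delta>" using len by linarith
    qed
    finally show ?thesis .
  qed
  from \<delta> this show ?thesis by (rule that)
qed

lemma negligible_imp_small_open_superset:
  assumes "negligible N" "d > 0"
  obtains U where "open U" "N \<subseteq> U" "U \<in> lmeasurable" "measure lebesgue U < d"
proof -
  obtain U where U: "open U" "N \<subseteq> U" "U - N \<in> lmeasurable" "emeasure lebesgue (U - N) < ennreal d"
    using sets_lebesgue_outer_open[OF negligible_imp_sets[OF assms(1)] assms(2)] by blast
  have U_eq: "U = (U - N) \<union> N" using U(2) by auto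
  have "U \<in> lmeasurable"
    using U(3) assms(1) U_eq by (metis fmeasurable.Un negligible_imp_measurable)
  moreover have "measure lebesgue U = measure lebesgue (U - N)"
    using measure_Un_null_set[of "U - N" lebesgue N] U(3) assms(1) U_eq
    by (metis fmeasurable_def mem_Collect_eq negligible_iff_null_sets sets.Int_space_eq2)
  moreover have "measure lebesgue (U - N) < d"
    using U(3,4) assms(2) by (simp add: emeasure_eq_measure2 ennreal_less_iff less_imp_le)
  ultimately show ?thesis using U(1,2) that by simp
qed

lemma covering_by_nonoverlapping_intervals:
  fixes N U :: "real set"
  assumes "N \<subseteq> {a..b}" "a < b" "open U" "N \<subseteq> U"
  obtains \<D> c d where "countable \<D>" "N \<subseteq> \<Union>\<D>" "pairwise (\<lambda>A B. interior A \<inter> interior B = {}) \<D>"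
    "\<And>K. K \<in> \<D> \<Longrightarrow> a \<le> c K \<and> c K < d K \<and> d K \<le> b \<and> {c K..d K} = K \<and> K \<subseteq> U"
proof -
  define \<gamma> where "\<gamma> x = (if x \<in> U then U else ball x 1)" for x :: real
  have "gauge \<gamma>" unfolding gauge_def \<gamma>_def using assms(3) by auto
  then obtain \<D> where \<D>: "countable \<D>" "\<Union>\<D> \<subseteq> cbox a b"
      "\<And>K. K \<in> \<D> \<Longrightarrow> interior K \<noteq> {} \<and> (\<exists>c d. K = cbox c d)"
      "pairwise (\<lambda>A B. interior A \<inter> interior B = {}) \<D>"
      "\<And>K. K \<in> \<D> \<Longrightarrow> \<exists>x \<in> N \<inter> K. K \<subseteq> \<gamma> x"
      "\<And>u v. cbox u v \<in> \<D> \<Longrightarrow> \<exists>n. \<forall>i \<in> Basis. v \<bullet> i - u \<bullet> i = (b \<bullet> i - a \<bullet> i) / 2^n"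
      "N \<subseteq> \<Union>\<D>"
    using covering_lemma[of N a b \<gamma>] assms(1,2) by auto
  have "\<exists>c d. a \<le> c \<and> c < d \<and> d \<le> b \<and> {c..d} = K \<and> K \<subseteq> U" if K: "K \<in> \<D>" for K
  proof -
    obtain c d where "K = cbox c d" using \<D>(3)[OF K] by blast
    moreover have "interior K \<noteq> {}" using \<D>(3)[OF K] by blast
    moreover have "K \<subseteq> {a..b}" using \<D>(2) K by auto
    moreover have "K \<subseteq> U"
      using \<D>(5)[OF K] assms(4) unfolding \<gamma>_def by fastforce
    ultimately show ?thesis by (intro exI[of _ c] exI[of _ d]) auto
  qed
  then obtain c d where "\<And>K. K \<in> \<D> \<Longrightarrow> a \<le> c K \<and> c K < d K \<and> d K \<le> b \<and> {c K..d K} = K \<and> K \<subseteq> U"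
    by metis
  with \<D>(1,4,7) that show ?thesis by blast
qed

text \<open>Lusin's property (N): cover \<open>N\<close> by nonoverlapping intervals inside an open set of small
  measure, and apply \<open>abs_cont_on_interval_sum_image_measure\<close> to finite subfamilies.\<close>

lemma abs_cont_on_interval_negligible_image:
  assumes F: "abs_cont_on_interval F a b" and N: "negligible N" "N \<subseteq> {a..b}"
  shows "negligible (F ` N)"
proof (cases "a < b")
  case False
  then have "N \<subseteq> {a}" using N(2) by auto
  then have "F ` N \<subseteq> {F a}" by auto
  then show ?thesis using negligible_subset negligible_sing by metis
next
  case ab: True
  show ?thesis
    unfolding negligible_outer_le
  proof (intro allI impI)
    fix e :: real assume e: "e > 0"
    obtain \<delta> where \<delta>: "\<delta> > 0" and small: "\<And>(D :: real set set) c d. finite D \<Longrightarrow>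
        (\<And>K. K \<in> D \<Longrightarrow> a \<le> c K \<and> c K \<le> d K \<and> d K \<le> b) \<Longrightarrow>
        disjoint_family_on (\<lambda>K. {c K<..<d K}) D \<Longrightarrow> (\<Sum>K\<in>D. d K - c K) < \<delta> \<Longrightarrow>
        (\<Sum>K\<in>D. measure lebesgue (F ` {c K..d K})) < e"
      using abs_cont_on_interval_sum_image_measure[OF F e] by blast
    obtain U where U: "open U" "N \<subseteq> U" "U \<in> lmeasurable" "measure lebesgue U < \<delta>"
      using negligible_imp_small_open_superset[OF N(1) \<delta>] by blast
    obtain \<D> c d where \<D>: "countable \<D>" "N \<subseteq> \<Union>\<D>" "pairwise (\<lambda>A B. interior A \<inter> interior B = {}) \<D>"
      and cd: "\<And>K. K \<in> \<D> \<Longrightarrow> a \<le> c K \<and> c K < d K \<and> d K \<le> b \<and> {c K..d K} = K \<and> K \<subseteq> U"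
      using covering_by_nonoverlapping_intervals[OF N(2) ab U(1,2)] by blast
    have interior_K: "interior K = {c K<..<d K}" if K: "K \<in> \<D>" for K
      using cd[OF K] interior_atLeastAtMost_real[of "c K" "d K"] by simp
    have image_meas: "F ` K \<in> lmeasurable" if K: "K \<in> \<D>" for K
    proof -
      have "{c K..d K} \<subseteq> {a..b}"
        unfolding atLeastatMost_subset_iff using cd[OF K] by auto
      then have "continuous_on {c K..d K} F"
        by (rule continuous_on_subset[OF abs_cont_on_interval_continuous_on[OF F]])
      then show ?thesis using cd[OF K] by (metis compact_Icc compact_continuous_image lmeasurable_compact)
    qed
    have bound: "measure lebesgue (\<Union>K\<in>\<D>'. F ` K) \<le> e" if \<D>': "\<D>' \<subseteq> \<D>" "finite \<D>'" for \<D>'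
    proof -
      have disj: "disjoint_family_on (\<lambda>K. {c K<..<d K}) \<D>'"
        using \<D>(3) \<D>'(1) interior_K unfolding disjoint_family_on_def pairwise_def by (metis subsetD)
      have "(\<Sum>K\<in>\<D>'. d K - c K) \<le> measure lebesgue U"
      proof (rule sum_interval_lengths_le_measure[OF \<D>'(2) U(3) _ disj])
        fix K assume "K \<in> \<D>'"
        then have "K \<in> \<D>" using \<D>'(1) by blast
        then show "c K \<le> d K \<and> {c K<..<d K} \<subseteq> U"
          using cd[of K] interior_K[of K] interior_subset[of K] by auto
      qed
      then have len: "(\<Sum>K\<in>\<D>'. d K - c K) < \<delta>" using U(4) by linarith
      have "a \<le> c K \<and> c K \<le> d K \<and> d K \<le> b" if "K \<in> \<D>'" for K
        using cd[of K] that \<D>'(1) by auto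
      then have "(\<Sum>K\<in>\<D>'. measure lebesgue (F ` {c K..d K})) < e"
        by (rule small[OF \<D>'(2) _ disj len])
      moreover have "measure lebesgue (\<Union>K\<in>\<D>'. F ` K) \<le> (\<Sum>K\<in>\<D>'. measure lebesgue (F ` K))"
        using \<D>' image_meas by (intro measure_UNION_le) auto
      moreover have "(\<Sum>K\<in>\<D>'. measure lebesgue (F ` K)) = (\<Sum>K\<in>\<D>'. measure lebesgue (F ` {c K..d K}))"
        using \<D>'(1) cd by (intro sum.cong) auto
      ultimately show ?thesis by linarith
    qed
    have "(\<Union>K\<in>\<D>. F ` K) \<in> lmeasurable" "measure lebesgue (\<Union>K\<in>\<D>. F ` K) \<le> e"
      using fmeasurable_UN_bound[OF \<D>(1) image_meas bound] measure_UN_bound[OF \<D>(1) image_meas bound]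
      by auto
    moreover have "F ` N \<subseteq> (\<Union>K\<in>\<D>. F ` K)" using \<D>(2) by blast
    ultimately show "\<exists>T. F ` N \<subseteq> T \<and> T \<in> lmeasurable \<and> measure lebesgue T \<le> e"
      by blast
  qed
qed

text \<open>Off a negligible set, the image of \<open>{a..b}\<close> has measure at most \<open>\<integral>\<bar>g\<bar>\<close> by the
  change-of-variables bound; on it, it is negligible by property (N). The image contains the
  interval between \<open>F a\<close> and \<open>F b\<close> by continuity.\<close>

lemma abs_cont_on_interval_abs_diff_le_integral:
  assumes F: "abs_cont_on_interval F a b" and ab: "a \<le> b" and N: "negligible N"
    and der: "\<And>x. x \<in> {a..b} - N \<Longrightarrow> (F has_real_derivative g x) (at x)"
    and int: "(\<lambda>x. \<bar>g x\<bar>) integrable_on {a..b}"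
  shows "\<bar>F b - F a\<bar> \<le> integral {a..b} (\<lambda>x. \<bar>g x\<bar>)"
proof -
  define S where "S = {a..b} - N"
  have S: "S \<in> sets lebesgue" unfolding S_def using negligible_imp_sets[OF N] by auto
  have der_S: "(F has_real_derivative g x) (at x within S)" if "x \<in> S" for x
    using der[of x] that unfolding S_def by (simp add: has_field_derivative_at_within)
  have neg1: "negligible {x \<in> {a..b} - S. \<bar>g x\<bar> \<noteq> 0}"
    by (rule negligible_subset[OF N]) (auto simp: S_def)
  have neg2: "negligible {x \<in> S - {a..b}. \<bar>g x\<bar> \<noteq> 0}"
    by (rule negligible_subset[OF negligible_empty]) (auto simp: S_def)
  have int_S: "(\<lambda>x. \<bar>g x\<bar>) integrable_on S"
    using integrable_spike_set[OF int neg1 neg2] .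
  have "integral S (\<lambda>x. \<bar>g x\<bar>) = integral {a..b} (\<lambda>x. \<bar>g x\<bar>)"
    using integral_spike_set[OF neg2 neg1] .
  then have M: "F ` S \<in> lmeasurable" and M_le: "measure lebesgue (F ` S) \<le> integral {a..b} (\<lambda>x. \<bar>g x\<bar>)"
    using measure_differentiable_image_real[OF S der_S int_S] by auto
  have neg_image: "negligible (F ` (N \<inter> {a..b}))"
    by (rule abs_cont_on_interval_negligible_image[OF F negligible_subset[OF N]]) auto
  have "connected (F ` {a..b})"
    by (rule connected_continuous_image[OF abs_cont_on_interval_continuous_on[OF F]]) simp
  then have "{min (F a) (F b) .. max (F a) (F b)} \<subseteq> F ` {a..b}"
    by (rule connected_contains_Icc) (use ab in \<open>auto simp: min_def max_def\<close>)
  also have "\<dots> \<subseteq> F ` S \<union> F ` (N \<inter> {a..b})" unfolding S_def by blast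
  finally have sub: "{min (F a) (F b) .. max (F a) (F b)} \<subseteq> F ` S \<union> F ` (N \<inter> {a..b})" .
  have "\<bar>F b - F a\<bar> = measure lebesgue {min (F a) (F b) .. max (F a) (F b)}"
    by (simp add: min_def max_def)
  also have "\<dots> \<le> measure lebesgue (F ` S \<union> F ` (N \<inter> {a..b}))"
    using sub M negligible_imp_measurable[OF neg_image]
    by (intro measure_mono_fmeasurable) auto
  also have "\<dots> = measure lebesgue (F ` S)"
    using M neg_image by (simp add: measure_Un_null_set negligible_iff_null_sets fmeasurable_def)
  finally show ?thesis using M_le by linarith
qed

lemma AE_lborel_negligible_exception:
  assumes "AE x in lborel. P (x::real)"
  shows "negligible {x. \<not> P x}"
proof -
  obtain N where N: "{x \<in> space lborel. \<not> P x} \<subseteq> N" "emeasure lborel N = 0" "N \<in> sets lborel"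
    using assms by (rule AE_E)
  then have "N \<in> null_sets lborel" by auto
  then have "negligible N"
    by (simp add: negligible_iff_null_sets null_sets_completionI)
  then show ?thesis using N(1) negligible_subset by auto
qed

lemma abs_cont_on_intervals_continuous:
  assumes "\<forall>a b. abs_cont_on_interval F a b"
  shows "continuous_on UNIV F"
proof -
  have "isCont F x" for x
    using abs_cont_on_interval_continuous_on[of F "x - 1" "x + 1"] assms
      continuous_on_interior[of "{x-1..x+1}" F x] by simp
  then show ?thesis by (simp add: continuous_at_imp_continuous_on)
qed

lemma abs_cont_on_interval_integral_eq:
  assumes F: "abs_cont_on_interval F a b" and N: "negligible N"
    and der: "\<And>x. x \<in> {a..b} - N \<Longrightarrow> (F has_real_derivative g x) (at x)"
    and g: "continuous_on {a..b} g" and u: "u \<in> {a..b}"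
  shows "F u - F a = integral {a..u} g"
proof -
  define \<Phi> where "\<Phi> x = integral {a..x} g" for x
  have d\<Phi>: "(\<Phi> has_real_derivative g x) (at x within {a..b})" if "x \<in> {a..b}" for x
    unfolding \<Phi>_def by (rule integral_has_real_derivative[OF g that])
  obtain M where M: "\<And>x. x \<in> {a..b} \<Longrightarrow> norm (g x) \<le> M"
    using compact_imp_bounded[OF compact_continuous_image[OF g compact_Icc]]
    unfolding bounded_iff by (metis imageI)
  have "0 \<le> M" using M[OF u] by (meson norm_ge_zero order_trans)
  have "M-lipschitz_on {a..b} \<Phi>"
  proof (rule lipschitz_onI[OF _ \<open>0 \<le> M\<close>])
    fix x y assume "x \<in> {a..b}" "y \<in> {a..b}"
    then show "dist (\<Phi> x) (\<Phi> y) \<le> M * dist x y"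
      using field_differentiable_bound[OF convex_real_interval(5) d\<Phi> M] by (simp add: dist_norm)
  qed
  then have "abs_cont_on_interval (\<lambda>x. F x - \<Phi> x) a b"
    by (intro abs_cont_on_interval_diff[OF F] lipschitz_on_imp_abs_cont_on_interval)
  then have ac: "abs_cont_on_interval (\<lambda>x. F x - \<Phi> x) a u"
    by (rule abs_cont_on_interval_subinterval) (use u in auto)
  \<comment> \<open>\<open>F - \<Phi>\<close> is absolutely continuous with derivative \<open>0\<close> off a negligible set, hence constant.\<close>
  have der0: "((\<lambda>x. F x - \<Phi> x) has_real_derivative 0) (at x)" if "x \<in> {a..u} - (N \<union> {a, b})" for x
  proof -
    have x: "x \<in> {a<..<b}" "x \<notin> N" using that u by auto
    have "(\<Phi> has_real_derivative g x) (at x)"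
      using d\<Phi>[of x] x(1) at_within_interior[of x "{a..b}"] by auto
    then have "((\<lambda>x. F x - \<Phi> x) has_real_derivative g x - g x) (at x)"
      using der[of x] x by (intro derivative_intros) auto
    then show ?thesis by simp
  qed
  have N': "negligible (N \<union> {a, b})" using N by simp
  have "\<bar>(F u - \<Phi> u) - (F a - \<Phi> a)\<bar> \<le> integral {a..u} (\<lambda>x. \<bar>0::real\<bar>)"
    by (rule abs_cont_on_interval_abs_diff_le_integral[OF ac _ N' der0]) (use u in auto)
  then show ?thesis unfolding \<Phi>_def by simp
qed

lemma abs_cont_has_real_derivative_everywhere:
  assumes F: "\<forall>a b. abs_cont_on_interval F a b"
    and ae: "AE x in lborel. (F has_real_derivative g x) (at x)"
    and g: "continuous_on UNIV g"
  shows "(F has_real_derivative g x) (at x)"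
proof -
  define N where "N = {x. \<not> (F has_real_derivative g x) (at x)}"
  have N: "negligible N" unfolding N_def by (rule AE_lborel_negligible_exception[OF ae])
  let ?a = "x - 1" and ?b = "x + 1"
  have gc: "continuous_on {?a..?b} g" using continuous_on_subset[OF g] by blast
  have eq: "F u = F ?a + integral {?a..u} g" if "u \<in> {?a<..<?b}" for u
    using abs_cont_on_interval_integral_eq[OF spec[OF spec[OF F]] N _ gc, of u] that
    unfolding N_def by auto
  have "((\<lambda>u. integral {?a..u} g) has_real_derivative g x) (at x within {?a..?b})"
    by (rule integral_has_real_derivative[OF gc]) auto
  then have "((\<lambda>u. integral {?a..u} g) has_real_derivative g x) (at x)"
    using at_within_interior[of x "{?a..?b}"] by simp
  then have "((\<lambda>u. F ?a + integral {?a..u} g) has_real_derivative g x) (at x)"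
    by (intro derivative_eq_intros) auto
  then show ?thesis
    by (rule has_field_derivative_transform_within_open[of _ _ _ "{?a<..<?b}"]) (use eq in auto)
qed

lemma abs_cont_abs_diff_le_integral:
  assumes F: "\<forall>a b. abs_cont_on_interval F a b"
    and ae: "AE x in lborel. (F has_real_derivative g x) (at x)"
    and int: "(\<lambda>x. \<bar>g x\<bar>) integrable_on {u..v}" and uv: "u \<le> v"
  shows "\<bar>F v - F u\<bar> \<le> integral {u..v} (\<lambda>x. \<bar>g x\<bar>)"
proof -
  define N where "N = {x. \<not> (F has_real_derivative g x) (at x)}"
  have N: "negligible N" unfolding N_def by (rule AE_lborel_negligible_exception[OF ae])
  show ?thesis
    by (rule abs_cont_on_interval_abs_diff_le_integral[OF spec[OF spec[OF F]] uv N _ int])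
       (auto simp: N_def)
qed

section \<open>Error of the left endpoint rule\<close>

definition left_rule_error :: "(real \<Rightarrow> real) \<Rightarrow> real \<Rightarrow> real \<Rightarrow> nat \<Rightarrow> real" where
  "left_rule_error g a h n = integral {a..a + real n * h} g - h * (\<Sum>j<n. g (a + real j * h))"

lemma integral_split_cells:
  fixes g :: "real \<Rightarrow> real"
  assumes "0 \<le> h" "g integrable_on {a..a + real n * h}"
  shows "integral {a..a + real n * h} g = (\<Sum>j<n. integral {a + real j * h..a + real j * h + h} g)"
  using assms(2)
proof (induction n)
  case (Suc n)
  have end_eq: "a + real (Suc n) * h = a + real n * h + h" by (simp add: algebra_simps)
  have "real n * h \<le> real (Suc n) * h" using assms(1) by (intro mult_right_mono) auto
  then have "{a..a + real n * h} \<subseteq> {a..a + real (Suc n) * h}" by auto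
  then have "g integrable_on {a..a + real n * h}"
    by (rule integrable_subinterval_real[OF Suc.prems])
  have "integral {a..a + real (Suc n) * h} g = integral {a..a + real n * h + h} g"
    by (simp only: end_eq)
  also have "\<dots> = integral {a..a + real n * h} g + integral {a + real n * h..a + real n * h + h} g"
    using Suc.prems assms(1) unfolding end_eq
    by (intro Henstock_Kurzweil_Integration.integral_combine[symmetric]) auto
  finally show ?case using Suc.IH[OF \<open>g integrable_on {a..a + real n * h}\<close>] by simp
qed simp

lemma left_rule_error_eq_sum_cells:
  fixes g :: "real \<Rightarrow> real"
  assumes "0 \<le> h" "g integrable_on {a..a + real n * h}"
  shows "left_rule_error g a h n
    = (\<Sum>j<n. integral {a + real j * h..a + real j * h + h} g - h * g (a + real j * h))"
  using integral_split_cells[OF assms]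
  by (simp add: left_rule_error_def sum_subtractf sum_distrib_left)

lemma left_rule_sum_of_derivative:
  assumes "\<And>x. (F has_real_derivative f x) (at x)" "0 \<le> h"
  shows "h * (\<Sum>j<n. f (a + real j * h)) = F (a + real n * h) - F a - left_rule_error f a h n"
proof -
  have "(f has_integral F (a + real n * h) - F a) {a..a + real n * h}"
    using assms
    by (intro fundamental_theorem_of_calculus)
       (auto simp: has_real_derivative_iff_has_vector_derivative[symmetric] intro: has_field_derivative_at_within)
  then show ?thesis by (simp add: left_rule_error_def integral_unique)
qed

lemma has_integral_power_shift:
  assumes "0 \<le> h"
  shows "((\<lambda>x::real. (x - c) ^ l) has_integral h ^ (l + 1) / (real l + 1)) {c..c + h}"
proof -
  have "((\<lambda>x::real. (x - c) ^ l) has_integral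
      ((c + h - c) ^ (l + 1) / (l + 1) - (c - c) ^ (l + 1) / (l + 1))) {c..c + h}"
  proof (rule fundamental_theorem_of_calculus)
    fix x assume "x \<in> {c..c + h}"
    have e: "(x - c) ^ l + real l * (x - c) ^ (l - Suc 0) * (x - c) = (1 + real l) * (x - c) ^ l"
      by (cases l) (auto simp: algebra_simps)
    have "((\<lambda>x::real. (x - c) ^ (l + 1) / (l + 1)) has_real_derivative (x - c) ^ l) (at x within {c..c + h})"
      by (auto intro!: derivative_eq_intros simp: e)
    then show "((\<lambda>x::real. (x - c) ^ (l + 1) / (l + 1)) has_vector_derivative (x - c) ^ l) (at x within {c..c + h})"
      by (simp add: has_real_derivative_iff_has_vector_derivative)
  qed (use assms in simp)
  then show ?thesis by (simp add: add.commute)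
qed

lemma taylor_remainder_le_oscillation:
  fixes f :: "nat \<Rightarrow> real \<Rightarrow> real"
  assumes der: "\<And>i x. i < d \<Longrightarrow> (f i has_real_derivative f (Suc i) x) (at x)"
    and osc: "\<And>t. t \<in> {c..u} \<Longrightarrow> \<bar>f d t - f d c\<bar> \<le> W" and cu: "c \<le> u"
  shows "\<bar>f 0 u - (\<Sum>l\<le>d. f l c / fact l * (u - c) ^ l)\<bar> \<le> W * (u - c) ^ d"
proof (cases "u = c \<or> d = 0")
  case True
  then show ?thesis
    using osc[of c] osc[of u] cu by (auto simp: sum.atMost_shift zero_power)
next
  case False
  then have "c < u" "d > 0" using cu by auto
  have "\<forall>i t. i < d \<and> c \<le> t \<and> t \<le> u \<longrightarrow> DERIV (f i) t :> f (Suc i) t"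
    using der by simp
  then obtain t where t: "c < t" "t < u"
    and f_u: "f 0 u = (\<Sum>l<d. f l c / fact l * (u - c) ^ l) + f d t / fact d * (u - c) ^ d"
    using Taylor_up[of d f "f 0" c u c] \<open>c < u\<close> \<open>d > 0\<close> by auto
  have "(\<Sum>l\<le>d. f l c / fact l * (u - c) ^ l) = (\<Sum>l<d. f l c / fact l * (u - c) ^ l) + f d c / fact d * (u - c) ^ d"
    by (simp add: lessThan_Suc_atMost[symmetric])
  then have "f 0 u - (\<Sum>l\<le>d. f l c / fact l * (u - c) ^ l) = (f d t - f d c) / fact d * (u - c) ^ d"
    unfolding f_u by (simp add: field_simps)
  then have "\<bar>f 0 u - (\<Sum>l\<le>d. f l c / fact l * (u - c) ^ l)\<bar> = \<bar>f d t - f d c\<bar> / fact d * (u - c) ^ d"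
    using cu by (simp add: abs_mult)
  also have "\<dots> \<le> W / 1 * (u - c) ^ d"
    using osc[of t] t cu by (intro mult_right_mono frac_le) (auto simp: fact_ge_1)
  finally show ?thesis by simp
qed

lemma derivative_chain_continuous_on:
  fixes f :: "nat \<Rightarrow> real \<Rightarrow> real"
  assumes "\<And>i x. i < d \<Longrightarrow> (f i has_real_derivative f (Suc i) x) (at x)" "continuous_on S (f d)"
  shows "continuous_on S (f 0)"
proof (cases "d = 0")
  case False
  then have "isCont (f 0) x" for x
    using assms(1)[of 0 x] DERIV_isCont by auto
  then show ?thesis by (simp add: continuous_at_imp_continuous_on)
qed (use assms(2) in simp)

lemma integral_cell_taylor_error:
  fixes f :: "nat \<Rightarrow> real \<Rightarrow> real"
  assumes h: "0 < h"
    and der: "\<And>i x. i < d \<Longrightarrow> (f i has_real_derivative f (Suc i) x) (at x)"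
    and cont: "continuous_on {c..c + h} (f d)"
    and osc: "\<And>u. u \<in> {c..c + h} \<Longrightarrow> \<bar>f d u - f d c\<bar> \<le> W"
  shows "\<bar>integral {c..c + h} (f 0) - (\<Sum>l\<le>d. f l c * h ^ (l + 1) / fact (l + 1))\<bar> \<le> h ^ (d + 1) * W"
proof -
  define P where "P u = (\<Sum>l\<le>d. f l c / fact l * (u - c) ^ l)" for u
  have P_int: "(P has_integral (\<Sum>l\<le>d. f l c * h ^ (l + 1) / fact (l + 1))) {c..c + h}"
  proof -
    have "(P has_integral (\<Sum>l\<le>d. f l c / fact l * (h ^ (l + 1) / (real l + 1)))) {c..c + h}"
      unfolding P_def using h
      by (intro has_integral_sum has_integral_mult_right has_integral_power_shift) auto
    then show ?thesis
      by (rule has_integral_eq_rhs) (intro sum.cong refl, simp add: field_simps)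
  qed
  have f_int: "(f 0 has_integral integral {c..c + h} (f 0)) {c..c + h}"
    using integrable_continuous_real[OF derivative_chain_continuous_on[where f = f, OF der cont]] by blast
  have "norm (integral {c..c + h} (\<lambda>u. f 0 u - P u)) \<le> integral {c..c + h} (\<lambda>_. W * h ^ d)"
  proof (rule integral_norm_bound_integral)
    show "(\<lambda>u. f 0 u - P u) integrable_on {c..c + h}"
      using f_int P_int by (blast intro: integrable_diff)
    fix u assume u: "u \<in> {c..c + h}"
    have "\<bar>f 0 u - P u\<bar> \<le> W * (u - c) ^ d"
      unfolding P_def using u osc by (intro taylor_remainder_le_oscillation[where f = f, OF der]) auto
    also have "\<dots> \<le> W * h ^ d"
      using u osc[of c] h by (intro mult_left_mono power_mono) auto
    finally show "norm (f 0 u - P u) \<le> W * h ^ d" by simp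
  qed (rule integrable_const_ivl)
  then show ?thesis
    using integral_diff[OF has_integral_integrable[OF f_int] has_integral_integrable[OF P_int]]
      integral_unique[OF P_int] h by (simp add: mult_ac)
qed

lemma left_rule_error_taylor:
  fixes f :: "nat \<Rightarrow> real \<Rightarrow> real" and w :: "real \<Rightarrow> real"
  assumes h: "0 < h"
    and der: "\<And>i x. i < d \<Longrightarrow> (f i has_real_derivative f (Suc i) x) (at x)"
    and cont: "continuous_on UNIV (f d)"
    and osc: "\<And>u v. a \<le> u \<Longrightarrow> u \<le> v \<Longrightarrow> v \<le> a + real n * h \<Longrightarrow> \<bar>f d v - f d u\<bar> \<le> integral {u..v} w"
    and w_int: "w integrable_on {a..a + real n * h}" and w_nonneg: "\<And>x. 0 \<le> w x"
  shows "\<bar>left_rule_error (f 0) a h n - (\<Sum>l\<in>{1..d}. h ^ (l + 1) / fact (l + 1) * (\<Sum>j<n. f l (a + real j * h)))\<bar>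
    \<le> h ^ (d + 1) * integral {a..a + real n * h} w"
proof -
  define x where "x j = a + real j * h" for j :: nat
  define b where "b = a + real n * h"
  define C where "C j = (\<Sum>l\<in>{1..d}. f l (x j) * h ^ (l + 1) / fact (l + 1))" for j
  have cell: "a \<le> x j" "x j + h \<le> b" if "j < n" for j
  proof -
    have "real j * h + h = real (Suc j) * h" by (simp add: algebra_simps)
    also have "\<dots> \<le> real n * h" using that h by (intro mult_right_mono) auto
    finally show "a \<le> x j" "x j + h \<le> b" unfolding x_def b_def using h by auto
  qed
  have w_sub: "w integrable_on {u..v}" if "a \<le> u" "v \<le> b" for u v
    using that by (intro integrable_subinterval_real[OF w_int[folded b_def]]) auto
  have cell_error: "\<bar>integral {x j..x j + h} (f 0) - h * f 0 (x j) - C j\<bar> \<le> h ^ (d + 1) * integral {x j..x j + h} w"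
    if j: "j < n" for j
  proof -
    have "\<bar>integral {x j..x j + h} (f 0) - (\<Sum>l\<le>d. f l (x j) * h ^ (l + 1) / fact (l + 1))\<bar>
        \<le> h ^ (d + 1) * integral {x j..x j + h} w"
    proof (rule integral_cell_taylor_error[where f = f, OF h der])
      show "continuous_on {x j..x j + h} (f d)" using cont continuous_on_subset by blast
      fix u assume u: "u \<in> {x j..x j + h}"
      have "\<bar>f d u - f d (x j)\<bar> \<le> integral {x j..u} w"
        using osc[of "x j" u] u cell[OF j] unfolding b_def by auto
      also have "\<dots> \<le> integral {x j..x j + h} w"
        using u cell[OF j] w_nonneg by (intro integral_subset_le w_sub) auto
      finally show "\<bar>f d u - f d (x j)\<bar> \<le> integral {x j..x j + h} w" .
    qed
    moreover have "(\<Sum>l\<le>d. f l (x j) * h ^ (l + 1) / fact (l + 1)) = h * f 0 (x j) + C j"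
      unfolding C_def by (simp add: atMost_atLeast0 sum.atLeast_Suc_atMost)
    ultimately show ?thesis by (simp add: algebra_simps)
  qed
  have "left_rule_error (f 0) a h n = (\<Sum>j<n. integral {x j..x j + h} (f 0) - h * f 0 (x j))"
    unfolding x_def using h derivative_chain_continuous_on[where f = f, OF der cont]
    by (intro left_rule_error_eq_sum_cells integrable_continuous_real)
       (auto intro: continuous_on_subset[OF _ subset_UNIV])
  moreover have "(\<Sum>l\<in>{1..d}. h ^ (l + 1) / fact (l + 1) * (\<Sum>j<n. f l (x j))) = (\<Sum>j<n. C j)"
    unfolding C_def sum_distrib_left by (rule sum.swap[THEN trans]) (simp add: mult_ac)
  ultimately have "\<bar>left_rule_error (f 0) a h n - (\<Sum>l\<in>{1..d}. h ^ (l + 1) / fact (l + 1) * (\<Sum>j<n. f l (x j)))\<bar>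
      = \<bar>\<Sum>j<n. integral {x j..x j + h} (f 0) - h * f 0 (x j) - C j\<bar>"
    by (simp add: sum_subtractf)
  also have "\<dots> \<le> (\<Sum>j<n. h ^ (d + 1) * integral {x j..x j + h} w)"
    by (rule order_trans[OF sum_abs sum_mono]) (rule cell_error, simp)
  also have "\<dots> = h ^ (d + 1) * integral {a..b} w"
    unfolding sum_distrib_left[symmetric] x_def b_def using h w_int by (simp add: integral_split_cells)
  finally show ?thesis unfolding x_def b_def .
qed

lemma left_rule_error_step:
  fixes f :: "nat \<Rightarrow> real \<Rightarrow> real" and w :: "real \<Rightarrow> real"
  assumes h: "0 < h"
    and der: "\<And>i x. i < d \<Longrightarrow> (f i has_real_derivative f (Suc i) x) (at x)"
    and cont: "continuous_on UNIV (f d)"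
    and osc: "\<And>u v. a \<le> u \<Longrightarrow> u \<le> v \<Longrightarrow> v \<le> a + real n * h \<Longrightarrow> \<bar>f d v - f d u\<bar> \<le> integral {u..v} w"
    and w_int: "w integrable_on {a..a + real n * h}" and w_nonneg: "\<And>x. 0 \<le> w x"
    and var: "\<And>l. l < d \<Longrightarrow> \<bar>f l (a + real n * h) - f l a\<bar> \<le> \<beta>"
  shows "\<bar>left_rule_error (f 0) a h n\<bar>
    \<le> (\<Sum>l\<in>{1..d}. h ^ l * (\<beta> + \<bar>left_rule_error (f l) a h n\<bar>)) + h ^ (d + 1) * integral {a..a + real n * h} w"
proof -
  \<comment> \<open>The Riemann sums of the derivatives in the Taylor expansion are traded for their integrals.\<close>
  have riemann_term: "\<bar>h ^ (l + 1) / fact (l + 1) * (\<Sum>j<n. f l (a + real j * h))\<bar> \<le> h ^ l * (\<beta> + \<bar>left_rule_error (f l) a h n\<bar>)"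
    if l: "l \<in> {1..d}" for l
  proof -
    have "Suc (l - 1) = l" "l - 1 < d" using l by auto
    then have "h * (\<Sum>j<n. f l (a + real j * h))
        = f (l - 1) (a + real n * h) - f (l - 1) a - left_rule_error (f l) a h n"
      using der[of "l - 1"] h by (intro left_rule_sum_of_derivative) auto
    then have "\<bar>h * (\<Sum>j<n. f l (a + real j * h))\<bar> \<le> \<beta> + \<bar>left_rule_error (f l) a h n\<bar>"
      using var[OF \<open>l - 1 < d\<close>] by linarith
    moreover have "h ^ l / fact (l + 1) \<le> h ^ l"
      using h fact_ge_1[of "l + 1", where 'a = real]
      by (simp add: divide_le_eq mult_le_cancel_left1 less_imp_le)
    ultimately have "h ^ l / fact (l + 1) * \<bar>h * (\<Sum>j<n. f l (a + real j * h))\<bar> \<le> h ^ l * (\<beta> + \<bar>left_rule_error (f l) a h n\<bar>)"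
      using h by (intro mult_mono) auto
    moreover have "\<bar>h ^ (l + 1) / fact (l + 1) * (\<Sum>j<n. f l (a + real j * h))\<bar>
        = h ^ l / fact (l + 1) * \<bar>h * (\<Sum>j<n. f l (a + real j * h))\<bar>"
      using h by (simp add: abs_mult field_simps)
    ultimately show ?thesis by simp
  qed
  have "\<bar>left_rule_error (f 0) a h n\<bar>
      \<le> \<bar>\<Sum>l\<in>{1..d}. h ^ (l + 1) / fact (l + 1) * (\<Sum>j<n. f l (a + real j * h))\<bar>
        + h ^ (d + 1) * integral {a..a + real n * h} w"
    using left_rule_error_taylor[where f = f, OF h der cont osc w_int w_nonneg] by linarith
  also have "\<bar>\<Sum>l\<in>{1..d}. h ^ (l + 1) / fact (l + 1) * (\<Sum>j<n. f l (a + real j * h))\<bar>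
      \<le> (\<Sum>l\<in>{1..d}. h ^ l * (\<beta> + \<bar>left_rule_error (f l) a h n\<bar>))"
    using riemann_term by (rule order_trans[OF sum_abs sum_mono])
  finally show ?thesis by simp
qed

text \<open>\<open>left_rule_error_const\<close> solves the recursion \<open>A d \<ge> 1 + d (1 + A (d - 1))\<close> that
  \<open>left_rule_error_step\<close> imposes on the constant in front of \<open>error_majorant\<close>.\<close>

fun left_rule_error_const :: "nat \<Rightarrow> real" where
  "left_rule_error_const 0 = 1"
| "left_rule_error_const (Suc d) = 1 + real (Suc d) * (1 + left_rule_error_const d)"

lemma left_rule_error_const_ge_1: "left_rule_error_const d \<ge> 1"
  by (induction d) auto

lemma left_rule_error_const_mono: "d' \<le> d \<Longrightarrow> left_rule_error_const d' \<le> left_rule_error_const d"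
proof (induction d)
  case (Suc d)
  have "left_rule_error_const d \<le> real (Suc d) * (1 + left_rule_error_const d)"
    using left_rule_error_const_ge_1[of d] by (simp add: algebra_simps)
  then show ?case using Suc by (cases "d' = Suc d") auto
qed simp

definition error_majorant :: "real \<Rightarrow> real \<Rightarrow> real \<Rightarrow> nat \<Rightarrow> real" where
  "error_majorant h J \<beta> d = h ^ (d + 1) * J + \<beta> * (\<Sum>l\<in>{1..d}. h ^ l)"

lemma error_majorant_nonneg: "0 \<le> h \<Longrightarrow> 0 \<le> J \<Longrightarrow> 0 \<le> \<beta> \<Longrightarrow> 0 \<le> error_majorant h J \<beta> d"
  unfolding error_majorant_def by (intro add_nonneg_nonneg mult_nonneg_nonneg sum_nonneg) auto

lemma power_mult_le_error_majorant:
  assumes "0 \<le> h" "0 \<le> J" "0 \<le> \<beta>" "l \<in> {1..d}"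
  shows "h ^ l * \<beta> \<le> error_majorant h J \<beta> d"
proof -
  have "h ^ l * \<beta> \<le> (\<Sum>i\<in>{1..d}. h ^ i) * \<beta>"
    using assms by (intro mult_right_mono member_le_sum) auto
  then show ?thesis using assms unfolding error_majorant_def by (simp add: mult.commute add_increasing)
qed

lemma power_mult_error_majorant_le:
  assumes "0 \<le> h" "0 \<le> J" "0 \<le> \<beta>" "l \<le> d"
  shows "h ^ l * error_majorant h J \<beta> (d - l) \<le> error_majorant h J \<beta> d"
proof -
  have "h ^ l * (\<Sum>i\<in>{1..d - l}. h ^ i) = (\<Sum>i\<in>{1..d - l}. h ^ (i + l))"
    by (simp add: sum_distrib_left power_add mult.commute)
  also have "\<dots> = (\<Sum>i\<in>{1 + l..d - l + l}. h ^ i)"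
    by (rule sum.shift_bounds_cl_nat_ivl[symmetric])
  also have "\<dots> \<le> (\<Sum>i\<in>{1..d}. h ^ i)"
    using assms by (intro sum_mono2) auto
  finally have "\<beta> * (h ^ l * (\<Sum>i\<in>{1..d - l}. h ^ i)) \<le> \<beta> * (\<Sum>i\<in>{1..d}. h ^ i)"
    using assms(3) by (intro mult_left_mono)
  moreover have "h ^ l * (h ^ (d - l + 1) * J) = h ^ (d + 1) * J"
    using assms(4) by (simp add: power_add[symmetric])
  moreover have "h ^ l * error_majorant h J \<beta> (d - l)
      = h ^ l * (h ^ (d - l + 1) * J) + \<beta> * (h ^ l * (\<Sum>i\<in>{1..d - l}. h ^ i))"
    unfolding error_majorant_def by (simp add: algebra_simps)
  ultimately show ?thesis
    unfolding error_majorant_def by linarith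
qed

lemma error_majorant_recursion_term:
  assumes "0 \<le> h" "0 \<le> J" "0 \<le> \<beta>" "l \<in> {1..Suc d}"
    and E: "E \<le> left_rule_error_const (Suc d - l) * error_majorant h J \<beta> (Suc d - l)"
  shows "h ^ l * (\<beta> + E) \<le> (1 + left_rule_error_const d) * error_majorant h J \<beta> (Suc d)"
proof -
  have "h ^ l * E \<le> h ^ l * (left_rule_error_const (Suc d - l) * error_majorant h J \<beta> (Suc d - l))"
    using assms(1) E by (intro mult_left_mono) auto
  also have "\<dots> = left_rule_error_const (Suc d - l) * (h ^ l * error_majorant h J \<beta> (Suc d - l))"
    by (simp add: ac_simps)
  also have "\<dots> \<le> left_rule_error_const (Suc d - l) * error_majorant h J \<beta> (Suc d)"
    using power_mult_error_majorant_le[of h J \<beta> l "Suc d"] assms left_rule_error_const_ge_1[of "Suc d - l"]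
    by (intro mult_left_mono) auto
  also have "\<dots> \<le> left_rule_error_const d * error_majorant h J \<beta> (Suc d)"
    using assms by (intro mult_right_mono left_rule_error_const_mono error_majorant_nonneg) auto
  finally have "h ^ l * E \<le> left_rule_error_const d * error_majorant h J \<beta> (Suc d)" .
  moreover have "h ^ l * \<beta> \<le> error_majorant h J \<beta> (Suc d)"
    using power_mult_le_error_majorant[of h J \<beta> l "Suc d"] assms by auto
  ultimately show ?thesis by (simp add: algebra_simps)
qed

lemma left_rule_error_bound:
  fixes f :: "nat \<Rightarrow> real \<Rightarrow> real" and w :: "real \<Rightarrow> real"
  assumes h: "0 < h"
    and der: "\<And>i x. i < m \<Longrightarrow> (f i has_real_derivative f (Suc i) x) (at x)"
    and cont: "continuous_on UNIV (f m)"
    and osc: "\<And>u v. a \<le> u \<Longrightarrow> u \<le> v \<Longrightarrow> v \<le> a + real n * h \<Longrightarrow> \<bar>f m v - f m u\<bar> \<le> integral {u..v} w"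
    and w_int: "w integrable_on {a..a + real n * h}" and w_nonneg: "\<And>x. 0 \<le> w x"
    and var: "\<And>l. l < m \<Longrightarrow> \<bar>f l (a + real n * h) - f l a\<bar> \<le> \<beta>" and \<beta>: "0 \<le> \<beta>"
  shows "\<bar>left_rule_error (f 0) a h n\<bar>
    \<le> left_rule_error_const m * error_majorant h (integral {a..a + real n * h} w) \<beta> m"
proof -
  define J where "J = integral {a..a + real n * h} w"
  have J: "0 \<le> J" unfolding J_def by (rule integral_nonneg[OF w_int]) (rule w_nonneg)
  let ?E = "\<lambda>k. \<bar>left_rule_error (f k) a h n\<bar>" and ?P = "error_majorant h J \<beta>"
  have "?E k \<le> left_rule_error_const d * ?P d" if "k + d = m" for k d
    using that
  proof (induction d arbitrary: k rule: less_induct)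
    case (less d)
    have "?E (k + 0) \<le> (\<Sum>l\<in>{1..d}. h ^ l * (\<beta> + ?E (k + l))) + h ^ (d + 1) * J"
      unfolding J_def
    proof (rule left_rule_error_step[where f = "\<lambda>i. f (k + i)", OF h _ _ _ w_int w_nonneg])
      fix i x assume "i < d"
      then show "(f (k + i) has_real_derivative f (k + Suc i) x) (at x)"
        using der[of "k + i" x] less.prems by simp
    next
      fix l assume "l < d"
      then show "\<bar>f (k + l) (a + real n * h) - f (k + l) a\<bar> \<le> \<beta>"
        using var[of "k + l"] less.prems by simp
    qed (use cont osc less.prems in auto)
    then have step: "?E k \<le> (\<Sum>l\<in>{1..d}. h ^ l * (\<beta> + ?E (k + l))) + h ^ (d + 1) * J"
      by simp
    have "h ^ (d + 1) * J \<le> ?P d"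
      unfolding error_majorant_def using \<beta> h by (simp add: sum_nonneg)
    show ?case
    proof (cases d)
      case 0
      then show ?thesis using step \<open>h ^ (d + 1) * J \<le> ?P d\<close> by simp
    next
      case (Suc d')
      have "h ^ l * (\<beta> + ?E (k + l)) \<le> (1 + left_rule_error_const d') * ?P d" if l: "l \<in> {1..d}" for l
        using less.IH[of "d - l" "k + l"] l less.prems h J \<beta> unfolding Suc
        by (intro error_majorant_recursion_term) auto
      then have "(\<Sum>l\<in>{1..d}. h ^ l * (\<beta> + ?E (k + l))) \<le> (\<Sum>l\<in>{1..d}. (1 + left_rule_error_const d') * ?P d)"
        by (rule sum_mono)
      then have "?E k \<le> real d * ((1 + left_rule_error_const d') * ?P d) + ?P d"
        using step \<open>h ^ (d + 1) * J \<le> ?P d\<close> by simp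
      also have "\<dots> = left_rule_error_const d * ?P d"
        using Suc by (simp add: algebra_simps)
      finally show ?thesis .
    qed
  qed
  from this[of 0 m] show ?thesis unfolding J_def by simp
qed

section \<open>Truncation, tails and the two norms\<close>

lemma left_rule_error_trap_rule:
  assumes "n > 0"
  shows "left_rule_error g (-T) (2 * T / real n) n = integral {-T..T} g - trap_rule n T g"
  using assms by (simp add: left_rule_error_def trap_rule_def algebra_simps)

lemma exp_decay_tail_integral:
  fixes g :: "real \<Rightarrow> real"
  assumes cont: "continuous_on UNIV g" and c: "0 < c"
    and bound: "\<And>x. T \<le> x \<Longrightarrow> \<bar>g x\<bar> \<le> K * exp (- c * (x - T))"
  shows "g absolutely_integrable_on {T..}" "\<bar>integral {T..} g\<bar> \<le> K / c"
proof -
  define m where "m x = K * exp (c * T) * exp (- c * x)" for x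
  have m_eq: "m x = K * exp (- c * (x - T))" for x
    unfolding m_def by (simp add: algebra_simps flip: exp_add)
  have "(m has_integral K * exp (c * T) * (exp (- c * T) / c)) {T..}"
    unfolding m_def by (intro has_integral_mult_right has_integral_exp_minus_to_infinity c)
  moreover have "K * exp (c * T) * (exp (- c * T) / c) = K / c"
    by (simp add: field_simps flip: exp_add)
  ultimately have m_int: "(m has_integral K / c) {T..}" by (simp only:)
  have le: "\<And>x. x \<in> {T..} \<Longrightarrow> norm (g x) \<le> m x" using bound m_eq by auto
  have "g \<in> borel_measurable (lebesgue_on {T..})"
    by (rule continuous_imp_measurable_on_sets_lebesgue) (use cont continuous_on_subset in auto)
  then have g_int: "g integrable_on {T..}"
    by (rule measurable_bounded_by_integrable_imp_integrable[OF _ has_integral_integrable[OF m_int] le]) auto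
  show "g absolutely_integrable_on {T..}"
    by (rule absolutely_integrable_integrable_bound[OF le g_int has_integral_integrable[OF m_int]])
  show "\<bar>integral {T..} g\<bar> \<le> K / c"
    using integral_norm_bound_integral[OF g_int has_integral_integrable[OF m_int] le] integral_unique[OF m_int]
    by simp
qed

lemma integral_lborel_minus_integral_le_tails:
  fixes g :: "real \<Rightarrow> real"
  assumes cont: "continuous_on UNIV g" and c: "0 < c" and T: "0 \<le> T"
    and bound: "\<And>x. T \<le> \<bar>x\<bar> \<Longrightarrow> \<bar>g x\<bar> \<le> K * exp (- c * (\<bar>x\<bar> - T))"
  shows "integrable lborel g" "\<bar>(LINT x|lborel. g x) - integral {-T..T} g\<bar> \<le> 2 * K / c"
proof -
  have "\<bar>g x\<bar> \<le> K * exp (- c * (x - T))" if "T \<le> x" for x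
    using bound[of x] that T by simp
  then have R1: "g absolutely_integrable_on {T..}" and R2: "\<bar>integral {T..} g\<bar> \<le> K / c"
    using exp_decay_tail_integral[OF cont c] by auto
  have "continuous_on UNIV (\<lambda>x. g (- x))"
    by (intro continuous_on_compose2[OF cont]) (auto intro: continuous_intros)
  moreover have "\<bar>g (- x)\<bar> \<le> K * exp (- c * (x - T))" if "T \<le> x" for x
    using bound[of "- x"] that T by simp
  ultimately have L1: "(\<lambda>x. g (- x)) absolutely_integrable_on {T..}"
    and L2: "\<bar>integral {T..} (\<lambda>x. g (- x))\<bar> \<le> K / c"
    using exp_decay_tail_integral[OF _ c] by blast+
  have "(\<lambda>x. g (- x)) absolutely_integrable_on {T..} \<and> integral {T..} (\<lambda>x. g (- x)) = integral {T..} (\<lambda>x. g (- x))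
      \<longleftrightarrow> g absolutely_integrable_on {..-T} \<and> integral {..-T} g = integral {T..} (\<lambda>x. g (- x))"
    by (rule has_absolute_integral_reflect_real) (auto simp: image_def intro: bexI[of _ "- _"])
  then have L3: "g absolutely_integrable_on {..-T}" and L4: "integral {..-T} g = integral {T..} (\<lambda>x. g (- x))"
    using L1 by auto
  have M: "g absolutely_integrable_on {-T..T}"
    using cont by (intro absolutely_integrable_continuous_real) (auto intro: continuous_on_subset)
  have has_int: "(g has_integral integral S g) S" if "g absolutely_integrable_on S" for S
    using that set_lebesgue_integral_eq_integral(1) by (blast intro: integrable_integral)
  have "(g has_integral (integral {..-T} g + integral {-T..T} g)) ({..-T} \<union> {-T..T})"
    by (rule has_integral_Un[OF has_int[OF L3] has_int[OF M]]) (rule negligible_subset[of "{-T}"], auto)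
  then have "(g has_integral (integral {..-T} g + integral {-T..T} g + integral {T..} g)) ({..-T} \<union> {-T..T} \<union> {T..})"
    by (rule has_integral_Un[OF _ has_int[OF R1]]) (rule negligible_subset[of "{T}"], use T in auto)
  moreover have univ: "{..-T} \<union> {-T..T} \<union> {T..} = (UNIV :: real set)" by auto
  ultimately have int_UNIV: "integral UNIV g = integral {..-T} g + integral {-T..T} g + integral {T..} g"
    by (metis integral_unique)
  have "g absolutely_integrable_on ({..-T} \<union> {-T..T} \<union> {T..})"
    by (intro set_integrable_Un L3 M R1) auto
  then have "integrable lebesgue g" unfolding univ set_integrable_def by simp
  moreover have "g \<in> borel_measurable borel" using cont by (simp add: borel_measurable_continuous_onI)
  ultimately show lborel: "integrable lborel g"
    using integrable_completion[of g lborel] by simp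
  have "(LINT x|lborel. g x) - integral {-T..T} g = integral {..-T} g + integral {T..} g"
    using integral_lborel[OF lborel] int_UNIV by simp
  then show "\<bar>(LINT x|lborel. g x) - integral {-T..T} g\<bar> \<le> 2 * K / c"
    using L2 L4 R2 by simp
qed

lemma exp_neg_square_le_exp_linear:
  fixes c T x :: real
  assumes "0 < c" "1 \<le> T" "T \<le> \<bar>x\<bar>"
  shows "exp (- c * x\<^sup>2 / 2) \<le> exp (- c * T\<^sup>2 / 2) * exp (- c * (\<bar>x\<bar> - T))"
proof -
  have "0 \<le> (\<bar>x\<bar> - T) * (\<bar>x\<bar> + T - 2)" using assms by (intro mult_nonneg_nonneg) auto
  then have "T\<^sup>2 + 2 * (\<bar>x\<bar> - T) \<le> x\<^sup>2"
    by (simp add: power2_eq_square algebra_simps abs_mult_self_eq)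
  then have "c * (T\<^sup>2 + 2 * (\<bar>x\<bar> - T)) \<le> c * x\<^sup>2" using assms by (intro mult_left_mono) auto
  then have "- c * x\<^sup>2 / 2 \<le> - c * T\<^sup>2 / 2 + (- c * (\<bar>x\<bar> - T))" by (simp add: algebra_simps)
  then show ?thesis by (simp flip: exp_add)
qed

lemma gaussian_decay_tails:
  fixes g :: "real \<Rightarrow> real"
  assumes "continuous_on UNIV g" "0 < c" "1 \<le> T"
    and decay: "\<And>x. \<bar>g x\<bar> \<le> D * exp (- c * x\<^sup>2 / 2)"
  shows "\<bar>(LINT x|lborel. g x) - integral {-T..T} g\<bar> \<le> 2 * D * exp (- c * T\<^sup>2 / 2) / c"
proof -
  have "0 \<le> D" using order_trans[OF abs_ge_zero decay[of 0]] by simp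
  have bound: "\<bar>g x\<bar> \<le> D * exp (- c * T\<^sup>2 / 2) * exp (- c * (\<bar>x\<bar> - T))" if "T \<le> \<bar>x\<bar>" for x
  proof -
    have "\<bar>g x\<bar> \<le> D * exp (- c * x\<^sup>2 / 2)" by (rule decay)
    also have "\<dots> \<le> D * (exp (- c * T\<^sup>2 / 2) * exp (- c * (\<bar>x\<bar> - T)))"
      using exp_neg_square_le_exp_linear[OF assms(2,3) that] \<open>0 \<le> D\<close> by (rule mult_left_mono)
    finally show ?thesis by (simp add: mult.assoc)
  qed
  have "\<bar>(LINT x|lborel. g x) - integral {-T..T} g\<bar> \<le> 2 * (D * exp (- c * T\<^sup>2 / 2)) / c"
    by (rule integral_lborel_minus_integral_le_tails(2)[OF assms(1,2) _ bound]) (use assms(3) in simp)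
  then show ?thesis by (simp add: mult.assoc)
qed

lemma abs_le_weighted_squares:
  fixes y l :: real
  assumes "0 < l"
  shows "\<bar>y\<bar> \<le> (l * y\<^sup>2 + 1 / l) / 2"
proof -
  have "0 \<le> (sqrt l * \<bar>y\<bar> - 1 / sqrt l)\<^sup>2" by simp
  also have "\<dots> = l * y\<^sup>2 + 1 / l - 2 * \<bar>y\<bar>"
    using assms by (simp add: power2_diff power_mult_distrib power_divide)
  finally show ?thesis by simp
qed

lemma square_integrable_on_interval:
  fixes g :: "real \<Rightarrow> real"
  assumes g: "g \<in> borel_measurable lborel" and g2: "integrable lborel (\<lambda>x. (g x)\<^sup>2)"
  shows "(\<lambda>x. (g x)\<^sup>2) integrable_on {u..v}"
    "(LINT x:{u..v}|lborel. (g x)\<^sup>2) = integral {u..v} (\<lambda>x. (g x)\<^sup>2)"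
    "(\<lambda>x. \<bar>g x\<bar>) integrable_on {u..v}"
proof -
  have sq: "set_integrable lborel {u..v} (\<lambda>x. (g x)\<^sup>2)"
    unfolding set_integrable_def by (rule integrable_mult_indicator) (use g2 in auto)
  then show "(\<lambda>x. (g x)\<^sup>2) integrable_on {u..v}" "(LINT x:{u..v}|lborel. (g x)\<^sup>2) = integral {u..v} (\<lambda>x. (g x)\<^sup>2)"
    using set_borel_integral_eq_integral by auto
  have "set_integrable lborel {u..v} (\<lambda>x. 1::real)"
    by (simp add: set_integrable_def integrable_real_indicator emeasure_lborel_Icc_eq)
  then have "integrable lborel (\<lambda>x. indicator {u..v} x *\<^sub>R (1::real) + indicator {u..v} x *\<^sub>R (g x)\<^sup>2)"
    using sq unfolding set_integrable_def by (rule Bochner_Integration.integrable_add)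
  then have "integrable lborel (\<lambda>x. indicator {u..v} x *\<^sub>R (1 + (g x)\<^sup>2))"
    by (simp only: scaleR_add_right)
  then have "set_integrable lborel {u..v} (\<lambda>x. \<bar>g x\<bar>)"
    unfolding set_integrable_def
  proof (rule Bochner_Integration.integrable_bound)
    show "(\<lambda>x. indicator {u..v} x *\<^sub>R \<bar>g x\<bar>) \<in> borel_measurable lborel"
      using g by measurable
    have "\<bar>g x\<bar> \<le> 1 + (g x)\<^sup>2" for x
      using abs_le_weighted_squares[of 2 "g x"] by simp
    then show "AE x in lborel. norm (indicator {u..v} x *\<^sub>R \<bar>g x\<bar>) \<le> norm (indicator {u..v} x *\<^sub>R (1 + (g x)\<^sup>2))"
      by (intro AE_I2) (auto simp: indicator_def)
  qed
  then show "(\<lambda>x. \<bar>g x\<bar>) integrable_on {u..v}"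
    using set_borel_integral_eq_integral by auto
qed

lemma integral_abs_le_sqrt_length_mult:
  fixes g :: "real \<Rightarrow> real"
  assumes sq: "(\<lambda>x. (g x)\<^sup>2) integrable_on {a..b}" and abs: "(\<lambda>x. \<bar>g x\<bar>) integrable_on {a..b}"
    and ab: "a \<le> b" and B: "integral {a..b} (\<lambda>x. (g x)\<^sup>2) \<le> S\<^sup>2" and S: "0 \<le> S"
  shows "integral {a..b} (\<lambda>x. \<bar>g x\<bar>) \<le> sqrt (b - a) * S"
proof -
  define J where "J = integral {a..b} (\<lambda>x. \<bar>g x\<bar>)"
  \<comment> \<open>Cauchy--Schwarz, via the weighted AM--GM inequality and an optimal choice of the weight \<open>l\<close>.\<close>
  have J_le: "J \<le> (l * S\<^sup>2 + (b - a) / l) / 2" if l: "0 < l" for l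
  proof -
    have int: "(\<lambda>x. (l * (g x)\<^sup>2 + 1 / l) / 2) integrable_on {a..b}"
      using integrable_add[OF integrable_cmul[OF sq, of l] integrable_const_ivl[of "1 / l" a b]] by simp
    have "J \<le> integral {a..b} (\<lambda>x. (l * (g x)\<^sup>2 + 1 / l) / 2)"
      unfolding J_def by (rule integral_le[OF abs int]) (use abs_le_weighted_squares[OF l] in auto)
    also have "\<dots> = integral {a..b} (\<lambda>x. l * (g x)\<^sup>2 + 1 / l) / 2"
      by (rule integral_divide)
    also have "\<dots> = (l * integral {a..b} (\<lambda>x. (g x)\<^sup>2) + (b - a) / l) / 2"
      using integral_add[OF integrable_cmul[OF sq, of l] integrable_const_ivl[of "1 / l" a b]] ab
      by (simp add: integral_mult_right)
    also have "\<dots> \<le> (l * S\<^sup>2 + (b - a) / l) / 2"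
      using B l by (intro divide_right_mono add_right_mono mult_left_mono) auto
    finally show ?thesis .
  qed
  consider "a = b" | "S = 0" "a < b" | "0 < S" "a < b" using S ab by linarith
  then show ?thesis
  proof cases
    case 1
    then show ?thesis by (simp add: J_def)
  next
    case 2
    have "J \<le> 0 + e" if e: "0 < e" for e
    proof -
      have "J \<le> (b - a) * e / (2 * (b - a + 1))"
        using J_le[of "(b - a + 1) / e"] 2 e by (simp add: field_simps)
      also have "\<dots> \<le> e"
        using mult_left_mono[of "b - a" "2 * (b - a + 1)" e] 2 e by (simp add: pos_divide_le_eq mult.commute)
      finally show ?thesis by simp
    qed
    then show ?thesis using 2 unfolding J_def[symmetric] by (simp add: field_le_epsilon)
  next
    case 3
    have "J \<le> ((sqrt (b - a) / S) * S\<^sup>2 + (b - a) / (sqrt (b - a) / S)) / 2"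
      by (rule J_le) (use 3 in simp)
    also have "\<dots> = sqrt (b - a) * S"
      using 3 by (simp add: field_simps power2_eq_square real_sqrt_mult[symmetric] flip: real_sqrt_mult)
    finally show ?thesis unfolding J_def .
  qed
qed

lemma decay_norm_bound:
  assumes bdd: "bdd_above ((\<lambda>p. decay_norm_term \<epsilon> G (fst p) (snd p)) ` (UNIV \<times> {..<\<alpha>}))"
    and "\<tau> < \<alpha>"
  shows "\<bar>G \<tau> x\<bar> \<le> decay_norm \<alpha> \<epsilon> G * exp (- (1 - \<epsilon>) * x\<^sup>2 / 2)"
proof -
  define a where "a = (1 - \<epsilon>) * x\<^sup>2 / 2"
  have "exp a * \<bar>G \<tau> x\<bar> \<le> decay_norm \<alpha> \<epsilon> G"
    using cSUP_upper[OF _ bdd, of "(x, \<tau>)"] assms(2)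
    by (simp add: decay_norm_def decay_norm_term_def abs_mult a_def)
  then have "exp a * \<bar>G \<tau> x\<bar> * exp (- a) \<le> decay_norm \<alpha> \<epsilon> G * exp (- a)"
    by (rule mult_right_mono) simp
  moreover have "exp a * \<bar>G \<tau> x\<bar> * exp (- a) = \<bar>G \<tau> x\<bar>"
    using exp_minus_inverse[of a] by (metis mult.commute mult.left_commute mult_1_right)
  moreover have "- (1 - \<epsilon>) * x\<^sup>2 / 2 = - a" by (simp add: a_def field_simps)
  ultimately show ?thesis by simp
qed

lemma star_norm_bound:
  assumes bdd: "bdd_above ((\<lambda>ab. star_norm_term \<alpha> G (fst ab) (snd ab)) ` {(a, b). a \<le> b})"
    and ab: "a \<le> b"
    and G: "G \<alpha> \<in> borel_measurable lborel" "integrable lborel (\<lambda>x. (G \<alpha> x)\<^sup>2)"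
  shows "integral {a..b} (\<lambda>x. (G \<alpha> x)\<^sup>2) \<le> (star_norm \<alpha> G)\<^sup>2" "0 \<le> star_norm \<alpha> G"
proof -
  define B where "B = integral {a..b} (\<lambda>x. (G \<alpha> x)\<^sup>2)"
  have "0 \<le> B"
    unfolding B_def using square_integrable_on_interval(1)[OF G] by (rule integral_nonneg) simp
  have "sqrt B \<le> star_norm_term \<alpha> G a b"
    unfolding star_norm_term_def B_def square_integrable_on_interval(2)[OF G]
    by (intro real_sqrt_le_mono) (simp add: sum_nonneg)
  also have "\<dots> \<le> star_norm \<alpha> G"
    unfolding star_norm_def using cSUP_upper[OF _ bdd, of "(a, b)"] ab by simp
  finally have "sqrt B \<le> star_norm \<alpha> G" .
  moreover have "0 \<le> sqrt B" using \<open>0 \<le> B\<close> by simp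
  ultimately show "0 \<le> star_norm \<alpha> G" by linarith
  have "B = (sqrt B)\<^sup>2" using \<open>0 \<le> B\<close> by simp
  also have "\<dots> \<le> (star_norm \<alpha> G)\<^sup>2"
    using \<open>sqrt B \<le> star_norm \<alpha> G\<close> \<open>0 \<le> B\<close> by (intro power_mono) auto
  finally show "integral {a..b} (\<lambda>x. (G \<alpha> x)\<^sup>2) \<le> (star_norm \<alpha> G)\<^sup>2"
    by (simp only: B_def)
qed

lemma gamma_inv_le_imp_ge:
  fixes \<gamma> :: "nat \<Rightarrow> real"
  assumes "mono \<gamma>" "filterlim \<gamma> at_top sequentially" "gamma_inv \<gamma> \<alpha> \<le> n"
  shows "real \<alpha> \<le> \<gamma> n"
proof -
  have "eventually (\<lambda>k. real \<alpha> \<le> \<gamma> k) sequentially"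
    using assms(2) by (simp add: filterlim_at_top)
  then obtain k where "real \<alpha> \<le> \<gamma> k"
    by (auto simp: eventually_sequentially)
  then have "real \<alpha> \<le> \<gamma> (gamma_inv \<gamma> \<alpha>)"
    unfolding gamma_inv_def by (rule LeastI)
  also have "\<dots> \<le> \<gamma> n" using assms(1,3) by (rule monoD)
  finally show ?thesis .
qed

section \<open>The trapezoidal rule on the real line\<close>

lemma trap_rule_error_le:
  fixes G :: "nat \<Rightarrow> real \<Rightarrow> real"
  assumes n: "0 < n" and T: "1 \<le> T" and c: "0 < c"
    and der: "\<And>i x. i < m \<Longrightarrow> (G i has_real_derivative G (Suc i) x) (at x)"
    and cont: "continuous_on UNIV (G m)"
    and osc: "\<And>u v. u \<le> v \<Longrightarrow> \<bar>G m v - G m u\<bar> \<le> integral {u..v} (\<lambda>x. \<bar>G (Suc m) x\<bar>)"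
    and abs_int: "(\<lambda>x. \<bar>G (Suc m) x\<bar>) integrable_on {-T..T}"
    and J: "integral {-T..T} (\<lambda>x. \<bar>G (Suc m) x\<bar>) \<le> J"
    and decay: "\<And>\<tau> x. \<tau> \<le> m \<Longrightarrow> \<bar>G \<tau> x\<bar> \<le> D * exp (- c * x\<^sup>2 / 2)"
  shows "\<bar>(LINT x|lborel. G 0 x) - trap_rule n T (G 0)\<bar>
    \<le> left_rule_error_const m * error_majorant (2 * T / n) J (2 * D * exp (- c * T\<^sup>2 / 2)) m
      + 2 * D * exp (- c * T\<^sup>2 / 2) / c"
proof -
  define h where "h = 2 * T / n"
  define \<beta> where "\<beta> = 2 * D * exp (- c * T\<^sup>2 / 2)"
  have h: "0 < h" and nh: "- T + real n * h = T" using n T by (auto simp: h_def)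
  have "0 \<le> D" using order_trans[OF abs_ge_zero decay[of 0 0]] by simp
  then have "0 \<le> \<beta>" by (simp add: \<beta>_def)
  have var: "\<bar>G l (- T + real n * h) - G l (- T)\<bar> \<le> \<beta>" if "l < m" for l
    using decay[of l T] decay[of l "- T"] that unfolding nh \<beta>_def by auto
  have "\<bar>left_rule_error (G 0) (- T) h n\<bar>
      \<le> left_rule_error_const m * error_majorant h (integral {- T..- T + real n * h} (\<lambda>x. \<bar>G (Suc m) x\<bar>)) \<beta> m"
  proof (rule left_rule_error_bound[where f = G, OF h der cont _ _ _ var \<open>0 \<le> \<beta>\<close>])
    show "\<bar>G m v - G m u\<bar> \<le> integral {u..v} (\<lambda>x. \<bar>G (Suc m) x\<bar>)"
      if "- T \<le> u" "u \<le> v" "v \<le> - T + real n * h" for u v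
      using osc[OF that(2)] .
    show "(\<lambda>x. \<bar>G (Suc m) x\<bar>) integrable_on {- T..- T + real n * h}"
      using abs_int unfolding nh .
  qed auto
  also have "\<dots> \<le> left_rule_error_const m * error_majorant h J \<beta> m"
    using J h left_rule_error_const_ge_1[of m] unfolding nh
    by (intro mult_left_mono) (auto simp: error_majorant_def)
  finally have quad: "\<bar>integral {-T..T} (G 0) - trap_rule n T (G 0)\<bar>
      \<le> left_rule_error_const m * error_majorant h J \<beta> m"
    using left_rule_error_trap_rule[OF n, of "G 0" T] by (simp add: h_def)
  have "continuous_on UNIV (G 0)" by (rule derivative_chain_continuous_on[where f = G, OF der cont])
  then have "\<bar>(LINT x|lborel. G 0 x) - integral {-T..T} (G 0)\<bar> \<le> \<beta> / c"
    unfolding \<beta>_def by (rule gaussian_decay_tails[OF _ c T]) (rule decay, simp)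
  with quad show ?thesis unfolding h_def \<beta>_def by linarith
qed

lemma error_majorant_le_rate:
  assumes n: "0 < n" and T: "1 \<le> 2 * T" and S: "0 \<le> S" and D: "0 \<le> D"
    and e: "0 \<le> e" "e \<le> 1 / real n ^ Suc m"
  defines "Q \<equiv> (2 * T) ^ Suc m * sqrt (2 * T)"
  shows "error_majorant (2 * T / n) (sqrt (2 * T) * S) (2 * D * e) m \<le> (S + 2 * real m * D) * Q / real n ^ Suc m"
proof -
  have "1 \<le> 2 * T * sqrt (2 * T)"
    using mult_mono[of 1 "2 * T" 1 "sqrt (2 * T)"] T by simp
  then have "(2 * T) ^ m * 1 \<le> (2 * T) ^ m * (2 * T * sqrt (2 * T))"
    using T by (intro mult_left_mono) auto
  then have Q: "(2 * T) ^ m \<le> Q" by (simp add: Q_def mult_ac)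
  have "(\<Sum>l\<in>{1..m}. (2 * T / n) ^ l) \<le> (\<Sum>l\<in>{1..m}. (2 * T) ^ m)"
  proof (rule sum_mono)
    fix l assume l: "l \<in> {1..m}"
    have "(2 * T / n) ^ l \<le> (2 * T) ^ l"
      using n T by (intro power_mono) (auto simp: divide_le_eq)
    also have "\<dots> \<le> (2 * T) ^ m" using T l by (intro power_increasing) auto
    finally show "(2 * T / n) ^ l \<le> (2 * T) ^ m" .
  qed
  also have "\<dots> \<le> real m * Q" using Q by (simp add: mult_left_mono)
  finally have "2 * D * e * (\<Sum>l\<in>{1..m}. (2 * T / n) ^ l) \<le> 2 * D * (1 / real n ^ Suc m) * (real m * Q)"
    using D e n T by (intro mult_mono mult_left_mono) (auto intro!: sum_nonneg)
  moreover have "(2 * T / n) ^ (m + 1) * (sqrt (2 * T) * S) = S * Q / real n ^ Suc m"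
    unfolding Q_def by (simp add: power_divide)
  moreover have "(S + 2 * real m * D) * Q / real n ^ Suc m = S * Q / real n ^ Suc m + 2 * D * (1 / real n ^ Suc m) * (real m * Q)"
    using n by (simp add: field_simps)
  ultimately show ?thesis
    unfolding error_majorant_def by linarith
qed

lemma trap_rule_error_rate:
  assumes n: "0 < n" and T: "1 \<le> T" and c: "0 < c" and S: "0 \<le> S" and D: "0 \<le> D"
    and e: "0 \<le> e" "e \<le> 1 / real n ^ Suc m" and A: "1 \<le> A"
  shows "A * error_majorant (2 * T / n) (sqrt (2 * T) * S) (2 * D * e) m + 2 * D * e / c
    \<le> (A * (2 * real m + 1) + 2 / c) * (S + D) * ((2 * T) ^ Suc m * sqrt (2 * T)) / real n ^ Suc m"
proof -
  define Q where "Q = (2 * T) ^ Suc m * sqrt (2 * T)"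
  define N where "N = real n ^ Suc m"
  have N: "0 < N" using n by (simp add: N_def)
  have "1 \<le> Q"
    unfolding Q_def using mult_mono[of 1 "(2 * T) ^ Suc m" 1 "sqrt (2 * T)"] one_le_power[of "2 * T" "Suc m"] T
    by simp
  have "A * error_majorant (2 * T / n) (sqrt (2 * T) * S) (2 * D * e) m \<le> A * ((S + 2 * real m * D) * Q / N)"
    using error_majorant_le_rate[of n T S D e m] assms unfolding Q_def N_def by (intro mult_left_mono) auto
  moreover have "e \<le> Q / N"
    using e(2) \<open>1 \<le> Q\<close> N unfolding N_def[symmetric] by (simp add: divide_right_mono order_trans)
  then have "2 * D * e / c \<le> 2 * D * (Q / N) / c"
    using c D by (intro divide_right_mono mult_left_mono) auto
  moreover have "A * ((S + 2 * real m * D) * Q / N) + 2 * D * (Q / N) / c = (A * (S + 2 * real m * D) + 2 * D / c) * (Q / N)"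
    using c N by (simp add: field_simps)
  moreover have "A * (S + 2 * real m * D) + 2 * D / c \<le> (A * (2 * real m + 1) + 2 / c) * (S + D)"
  proof -
    have "S + 2 * real m * D \<le> (2 * real m + 1) * (S + D)"
      using S D mult_nonneg_nonneg[of "real m" S] by (simp add: algebra_simps)
    then have "A * (S + 2 * real m * D) \<le> A * ((2 * real m + 1) * (S + D))"
      using A by (intro mult_left_mono) auto
    moreover have "2 * D / c \<le> 2 / c * (S + D)"
      using S c by (simp add: field_simps)
    ultimately show ?thesis by (simp add: algebra_simps)
  qed
  then have "(A * (S + 2 * real m * D) + 2 * D / c) * (Q / N) \<le> (A * (2 * real m + 1) + 2 / c) * (S + D) * (Q / N)"
    using N \<open>1 \<le> Q\<close> by (intro mult_right_mono) auto
  ultimately show ?thesis unfolding Q_def N_def by (simp add: mult.assoc)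
qed

lemma truncation_point:
  fixes \<gamma> c :: real
  assumes c: "0 < c" "c \<le> 1" and n: "2 \<le> n" and \<alpha>: "1 \<le> \<alpha>" "real \<alpha> \<le> \<gamma>"
  defines "T \<equiv> sqrt (2 / c * \<gamma> * ln (real n))"
  shows "1 \<le> T" "exp (- c * T\<^sup>2 / 2) \<le> 1 / real n ^ \<alpha>"
    "(2 * T) ^ \<alpha> * sqrt (2 * T) = (8 / c) powr (real \<alpha> / 2 + 1 / 4) * (\<gamma> * ln (real n)) powr (real \<alpha> / 2 + 1 / 4)"
proof -
  define L where "L = \<gamma> * ln (real n)"
  have "2 / 3 \<le> ln (2::real)" by (rule ln2_ge_two_thirds)
  also have "\<dots> \<le> ln (real n)" using n by simp
  finally have ln_n: "2 / 3 \<le> ln (real n)" .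
  have "1 \<le> \<gamma>" using \<alpha> by linarith
  then have L: "1 * (2 / 3) \<le> L"
    unfolding L_def using ln_n by (intro mult_mono) auto
  have "2 \<le> 2 / c" using c by (simp add: le_divide_eq)
  then have "2 * (2 / 3) \<le> 2 / c * L"
    using L c by (intro mult_mono) auto
  then have X: "1 \<le> 2 / c * L" by linarith
  then show "1 \<le> T" by (simp add: T_def L_def mult.assoc)
  have T2: "T\<^sup>2 = 2 / c * L"
    using X by (simp add: T_def L_def mult.assoc)
  have "c * T\<^sup>2 / 2 = L" unfolding T2 using c by simp
  then have "exp (- c * T\<^sup>2 / 2) = exp (- L)" by simp
  also have "\<dots> \<le> exp (- (real \<alpha> * ln (real n)))"
    unfolding L_def using \<alpha> ln_n by (simp add: mult_right_mono)
  also have "\<dots> = 1 / real n ^ \<alpha>"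
    using n by (simp add: exp_minus ln_realpow[symmetric] inverse_eq_divide)
  finally show "exp (- c * T\<^sup>2 / 2) \<le> 1 / real n ^ \<alpha>" .
  have pos: "0 < 2 * T" using \<open>1 \<le> T\<close> by simp
  have "(2 * T) ^ \<alpha> * sqrt (2 * T) = (2 * T) powr real \<alpha> * (2 * T) powr (1 / 2)"
    using pos by (simp add: powr_realpow powr_half_sqrt)
  also have "\<dots> = (2 * T) powr (2 * (real \<alpha> / 2 + 1 / 4))"
    by (simp add: powr_add[symmetric] algebra_simps)
  also have "\<dots> = ((2 * T) powr 2) powr (real \<alpha> / 2 + 1 / 4)"
    by (simp add: powr_powr)
  also have "(2 * T) powr 2 = 8 / c * L"
    using pos by (simp add: power_mult_distrib T2)
  also have "(8 / c * L) powr (real \<alpha> / 2 + 1 / 4) = (8 / c) powr (real \<alpha> / 2 + 1 / 4) * L powr (real \<alpha> / 2 + 1 / 4)"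
    by (rule powr_mult)
  finally show "(2 * T) ^ \<alpha> * sqrt (2 * T) = (8 / c) powr (real \<alpha> / 2 + 1 / 4) * (\<gamma> * ln (real n)) powr (real \<alpha> / 2 + 1 / 4)"
    by (simp add: L_def)
qed

definition trap_rule_const :: "nat \<Rightarrow> real \<Rightarrow> real" where
  "trap_rule_const \<alpha> \<epsilon> = (left_rule_error_const (\<alpha> - 1) * (2 * real (\<alpha> - 1) + 1) + 2 / (1 - \<epsilon>))
    * (8 / (1 - \<epsilon>)) powr (real \<alpha> / 2 + 1 / 4)"

lemma trap_rule_error_gamma:
  fixes \<gamma> :: "nat \<Rightarrow> real" and G :: "nat \<Rightarrow> real \<Rightarrow> real"
  assumes \<alpha>: "1 \<le> \<alpha>" and \<epsilon>: "0 < \<epsilon>" "\<epsilon> < 1"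
    and \<gamma>: "mono \<gamma>" "filterlim \<gamma> at_top sequentially"
    and AC: "\<forall>\<tau><\<alpha>. \<forall>a b. abs_cont_on_interval (G \<tau>) a b"
    and AE: "\<forall>\<tau><\<alpha>. AE x in lborel. (G \<tau> has_real_derivative G (Suc \<tau>) x) (at x)"
    and L2: "G \<alpha> \<in> borel_measurable lborel" "integrable lborel (\<lambda>x. (G \<alpha> x)\<^sup>2)"
    and bdd_star: "bdd_above ((\<lambda>ab. star_norm_term \<alpha> G (fst ab) (snd ab)) ` {(a, b). a \<le> b})"
    and bdd_decay: "bdd_above ((\<lambda>p. decay_norm_term \<epsilon> G (fst p) (snd p)) ` (UNIV \<times> {..<\<alpha>}))"
    and n: "gamma_inv \<gamma> \<alpha> \<le> n" "2 \<le> n"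
  shows "\<bar>(LINT x|lborel. G 0 x) - trap_rule n (sqrt (2 / (1 - \<epsilon>) * \<gamma> n * ln (real n))) (G 0)\<bar>
    \<le> trap_rule_const \<alpha> \<epsilon> * (star_norm \<alpha> G + decay_norm \<alpha> \<epsilon> G)
      * (\<gamma> n * ln (real n)) powr (real \<alpha> / 2 + 1 / 4) / real n ^ \<alpha>"
proof -
  obtain m where m: "\<alpha> = Suc m" using \<alpha> by (cases \<alpha>) auto
  define c where "c = 1 - \<epsilon>"
  define T where "T = sqrt (2 / c * \<gamma> n * ln (real n))"
  define S where "S = star_norm \<alpha> G"
  define D where "D = decay_norm \<alpha> \<epsilon> G"
  have c: "0 < c" "c \<le> 1" using \<epsilon> by (auto simp: c_def)
  note T = truncation_point[OF c n(2) \<alpha> gamma_inv_le_imp_ge[OF \<gamma> n(1)], folded T_def]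
  have S: "0 \<le> S" "integral {-T..T} (\<lambda>x. (G (Suc m) x)\<^sup>2) \<le> S\<^sup>2"
    using star_norm_bound[OF bdd_star _ L2, of "- T" T] T(1) by (auto simp: S_def m)
  have decay: "\<bar>G \<tau> x\<bar> \<le> D * exp (- c * x\<^sup>2 / 2)" if "\<tau> \<le> m" for \<tau> x
    using decay_norm_bound[OF bdd_decay, of \<tau> x] that by (simp add: D_def c_def m)
  then have "0 \<le> D" using order_trans[OF abs_ge_zero decay[of 0 0]] by simp
  have "\<bar>(LINT x|lborel. G 0 x) - trap_rule n T (G 0)\<bar>
      \<le> left_rule_error_const m * error_majorant (2 * T / n) (sqrt (2 * T) * S) (2 * D * exp (- c * T\<^sup>2 / 2)) m
        + 2 * D * exp (- c * T\<^sup>2 / 2) / c"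
  proof (rule trap_rule_error_le[OF _ T(1) c(1) _ _ _ _ _ decay])
    show "(G i has_real_derivative G (Suc i) x) (at x)" if "i < m" for i x
      using that AC AE m by (intro abs_cont_has_real_derivative_everywhere abs_cont_on_intervals_continuous) auto
    show "continuous_on UNIV (G m)" using AC m by (intro abs_cont_on_intervals_continuous) auto
    show "\<bar>G m v - G m u\<bar> \<le> integral {u..v} (\<lambda>x. \<bar>G (Suc m) x\<bar>)" if "u \<le> v" for u v
      using that AC AE m square_integrable_on_interval(3)[OF L2]
      by (intro abs_cont_abs_diff_le_integral) auto
    show "integral {-T..T} (\<lambda>x. \<bar>G (Suc m) x\<bar>) \<le> sqrt (2 * T) * S"
      using integral_abs_le_sqrt_length_mult[of "G (Suc m)" "- T" T S] square_integrable_on_interval[OF L2] S T(1)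
      by (simp add: m)
  qed (use n square_integrable_on_interval(3)[OF L2] m in auto)
  also have "\<dots> \<le> (left_rule_error_const m * (2 * real m + 1) + 2 / c) * (S + D)
      * ((2 * T) ^ Suc m * sqrt (2 * T)) / real n ^ Suc m"
    using T(1,2) c S(1) \<open>0 \<le> D\<close> n(2) left_rule_error_const_ge_1[of m]
    by (intro trap_rule_error_rate) (auto simp: m)
  also have "\<dots> = trap_rule_const \<alpha> \<epsilon> * (S + D) * (\<gamma> n * ln (real n)) powr (real \<alpha> / 2 + 1 / 4) / real n ^ \<alpha>"
    using T(3) by (simp add: trap_rule_const_def m c_def)
  finally show ?thesis by (simp add: T_def c_def S_def D_def)
qed

theorem corollary4p4:
  fixes \<alpha> :: nat and \<epsilon> :: real
  assumes "\<alpha> \<ge> 1" and "0 < \<epsilon>" and "\<epsilon> < 1"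
  shows "\<exists>C. \<forall>(\<gamma>::nat \<Rightarrow> real) (G::nat \<Rightarrow> real \<Rightarrow> real) (n::nat).
     (\<forall>m. \<gamma> m \<ge> 0) \<and> mono \<gamma> \<and> filterlim \<gamma> at_top sequentially \<and>
     (\<forall>\<tau><\<alpha>. \<forall>a b. abs_cont_on_interval (G \<tau>) a b) \<and>
     (\<forall>\<tau><\<alpha>. AE x in lborel. (G \<tau> has_real_derivative G (Suc \<tau>) x) (at x)) \<and>
     G \<alpha> \<in> borel_measurable lborel \<and> integrable lborel (\<lambda>x. (G \<alpha> x)\<^sup>2) \<and>
     bdd_above ((\<lambda>ab. star_norm_term \<alpha> G (fst ab) (snd ab)) ` {(a, b). a \<le> b}) \<and>
     bdd_above ((\<lambda>p. decay_norm_term \<epsilon> G (fst p) (snd p)) ` (UNIV \<times> {..<\<alpha>})) \<and>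
     n \<ge> gamma_inv \<gamma> \<alpha> \<and> n \<ge> 2
     \<longrightarrow> \<bar>(LINT x|lborel. G 0 x) -
           trap_rule n (sqrt (2 / (1 - \<epsilon>) * \<gamma> n * ln (real n))) (G 0)\<bar>
         \<le> C * (star_norm \<alpha> G + decay_norm \<alpha> \<epsilon> G) *
             (\<gamma> n * ln (real n)) powr (real \<alpha> / 2 + 1 / 4) / real n ^ \<alpha>"
  by (intro exI[of _ "trap_rule_const \<alpha> \<epsilon>"] allI impI, elim conjE) (rule trap_rule_error_gamma[OF assms])

end
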